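(* The variety $NMal_5$ of five-dimensional nilpotent Malcev algebra structures over $\mathbb{C}$ has exactly two irreducible components $\mathcal{C}_1$ and $\mathcal{C}_2$, where $$\mathcal{C}_1=\overline{O(g_{5,6})}=NLie_5,\qquad \mathcal{C}_2=\overline{O(M_5)}=NMal_5\setminus\left(O(g_{5,6})\cup O(g_{5,5})\cup O(g_{5,4})\right).$$ In particular, the set of rigid algebras of $NMal_5$ (up to isomorphism) is $Rig(NMal_5)=\{g_{5,6},M_5\}$.
   Context: All algebras are over $\mathbb{C}$. With $J(x,y,z)=(xy)z+(yz)x+(zx)y$, an algebra is a Malcev algebra if it satisfies $xy=-yx$ and $J(x,y,xz)=J(x,y,z)x$. Fix an $n$-dimensional vector space $V$ (here $n=5$). $NMal_n$ (resp. $NLie_n$) is the Zariski closed subset of $\mathrm{Hom}(V\otimes V,V)\cong\mathbb{C}^{n^3}$ consisting of nilpotent Malcev (resp. nilpotent Lie) multiplications on $V$. $GL_n(\mathbb{C})$ acts by $(g*\mu)(x\otimes y)=g(\mu(g^{-1}x\otimes g^{-1}y))$; for an $n$-dimensional algebra $A$, $O(A)$ denotes the orbit of structures isomorphic to $A$. Closures are Zariski closures. An irreducible component is a maximal irreducible closed subset. An algebra $A$ is rigid in a variety if $O(A)$ is an open subset of the variety; $Rig(\cdot)$ is the set of rigid algebras up to isomorphism. Known classification: every five-dimensional nilpotent Malcev algebra is isomorphic to exactly one of the following, given in a basis $e_1,\dots,e_5$ (products not listed are zero or follow from anticommutativity): $\mathbb{C}^5$: zero multiplication. $n_3\oplus\mathbb{C}^2$: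 $e_1e_2=e_3$. $n_4\oplus\mathbb{C}$: $e_1e_2=e_3$, $e_1e_3=e_4$. $g_{5,1}$: $e_1e_2=e_5$, $e_3e_4=e_5$. $g_{5,2}$: $e_1e_2=e_4$, $e_1e_3=e_5$. $g_{5,3}$: $e_1e_2=e_3$, $e_1e_4=e_5$, $e_2e_3=e_5$. $g_{5,4}$: $e_1e_2=e_3$, $e_1e_3=e_4$, $e_2e_3=e_5$. $g_{5,5}$: $e_1e_2=e_3$, $e_1e_3=e_4$, $e_1e_4=e_5$. $g_{5,6}$: $e_1e_2=e_3$, $e_1e_3=e_4$, $e_1e_4=e_5$, $e_2e_3=e_5$. $M_5$: $e_1e_2=e_4$, $e_3e_4=e_5$. All of these except $M_5$ are Lie algebras. *)

theory Defs
  imports "HOL-Analysis.Analysis"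
begin

section \<open>Multiplications on a finite-dimensional complex vector space\<close>

text \<open>
  \<open>Hom(V \<otimes> V, V)\<close> for \<open>V = \<complex>\<^sup>n\<close> is identified with \<open>\<complex>\<close> to the power \<open>n\<^sup>3\<close> by structure constants:
  for \<open>\<mu> :: 'n mult\<close> the vector \<open>\<mu> $ i $ j\<close> is the product of the basis vectors \<open>e\<^sub>i\<close> and \<open>e\<^sub>j\<close>.
\<close>

type_synonym 'n mult = "complex ^ 'n ^ 'n ^ 'n"

definition amul :: "'n::finite mult \<Rightarrow> complex ^ 'n \<Rightarrow> complex ^ 'n \<Rightarrow> complex ^ 'n" where
  "amul \<mu> x y = (\<Sum>i\<in>UNIV. \<Sum>j\<in>UNIV. (x $ i * y $ j) *s (\<mu> $ i $ j))"

definition jacobian ::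
  "'n::finite mult \<Rightarrow> complex ^ 'n \<Rightarrow> complex ^ 'n \<Rightarrow> complex ^ 'n \<Rightarrow> complex ^ 'n" where
  "jacobian \<mu> x y z = amul \<mu> (amul \<mu> x y) z + amul \<mu> (amul \<mu> y z) x + amul \<mu> (amul \<mu> z x) y"

definition anticommutative :: "'n::finite mult \<Rightarrow> bool" where
  "anticommutative \<mu> \<longleftrightarrow> (\<forall>x y. amul \<mu> x y = - amul \<mu> y x)"

definition malcev :: "'n::finite mult \<Rightarrow> bool" where
  "malcev \<mu> \<longleftrightarrow> anticommutative \<mu> \<and>
     (\<forall>x y z. jacobian \<mu> x y (amul \<mu> x z) = amul \<mu> (jacobian \<mu> x y z) x)"

definition lie :: "'n::finite mult \<Rightarrow> bool" where
  "lie \<mu> \<longleftrightarrow> anticommutative \<mu> \<and> (\<forall>x y z. jacobian \<mu> x y z = 0)"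

text \<open>
  Powers of a nonassociative algebra: \<open>A\<^sup>1 = A\<close>, and \<open>A\<^sup>k\<close> is the sum of all \<open>A\<^sup>i A\<^sup>k\<^sup>-\<^sup>i\<close>, \<open>0 < i < k\<close>.
  The value at \<open>k = 0\<close> is irrelevant.
\<close>

fun alg_power :: "'n::finite mult \<Rightarrow> nat \<Rightarrow> (complex ^ 'n) set" where
  "alg_power \<mu> k = (if k \<le> 1 then UNIV else
     vec.span (\<Union>i\<in>{0<..<k}. {amul \<mu> x y |x y. x \<in> alg_power \<mu> i \<and> y \<in> alg_power \<mu> (k - i)}))"

declare alg_power.simps [simp del]

definition nilpotent :: "'n::finite mult \<Rightarrow> bool" where
  "nilpotent \<mu> \<longleftrightarrow> (\<exists>k\<ge>1. alg_power \<mu> k = {0})"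

definition NMal :: "'n::finite mult set" where
  "NMal = {\<mu>. malcev \<mu> \<and> nilpotent \<mu>}"

definition NLie :: "'n::finite mult set" where
  "NLie = {\<mu>. lie \<mu> \<and> nilpotent \<mu>}"


section \<open>The action of the general linear group\<close>

definition act :: "complex ^ 'n ^ 'n \<Rightarrow> 'n::finite mult \<Rightarrow> 'n mult" where
  "act g \<mu> = (\<chi> i j. g *v amul \<mu> (matrix_inv g *v axis i 1) (matrix_inv g *v axis j 1))"

definition orbit :: "'n::finite mult \<Rightarrow> 'n mult set" where
  "orbit \<mu> = {act g \<mu> |g. invertible g}"

lemma amul_axis [simp]: "amul \<mu> (axis i 1) (axis j 1) = \<mu> $ i $ j"
proof -
  have "amul \<mu> (axis i 1) (axis j 1)
      = (\<Sum>k\<in>UNIV. \<Sum>l\<in>UNIV. if k = i then if l = j then \<mu> $ k $ l else 0 else 0)"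
    unfolding amul_def by (intro sum.cong refl) (auto simp: axis_def vec_eq_iff)
  also have "\<dots> = (\<Sum>k\<in>UNIV. if k = i then \<mu> $ k $ j else 0)"
    by (intro sum.cong refl) auto
  finally show ?thesis by simp
qed

lemma amul_sum_left: "amul \<mu> (\<Sum>a\<in>S. f a) y = (\<Sum>a\<in>S. amul \<mu> (f a) y)"
proof -
  have add: "amul \<mu> (u + v) y = amul \<mu> u y + amul \<mu> v y" for u v
    by (simp add: amul_def vec_eq_iff sum.distrib algebra_simps)
  have "amul \<mu> 0 y = 0" by (simp add: amul_def vec_eq_iff)
  then show ?thesis by (induction S rule: infinite_finite_induct) (auto simp: add)
qed

lemma amul_sum_right: "amul \<mu> x (\<Sum>a\<in>S. f a) = (\<Sum>a\<in>S. amul \<mu> x (f a))"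
proof -
  have add: "amul \<mu> x (u + v) = amul \<mu> x u + amul \<mu> x v" for u v
    by (simp add: amul_def vec_eq_iff sum.distrib algebra_simps)
  have "amul \<mu> x 0 = 0" by (simp add: amul_def vec_eq_iff)
  then show ?thesis by (induction S rule: infinite_finite_induct) (auto simp: add)
qed

lemma amul_scale_left: "amul \<mu> (c *s x) y = c *s amul \<mu> x y"
  by (simp add: amul_def vec_eq_iff sum_distrib_left mult.assoc)

lemma amul_scale_right: "amul \<mu> x (c *s y) = c *s amul \<mu> x y"
  by (simp add: amul_def vec_eq_iff sum_distrib_left mult.assoc mult.left_commute)

lemma mult_eqI:
  assumes "\<And>x y. amul \<mu> x y = amul \<nu> x y"
  shows "\<mu> = \<nu>"
  using assms by (metis amul_axis vec_eq_iff)

lemma amul_act: "amul (act g \<mu>) x y = g *v amul \<mu> (matrix_inv g *v x) (matrix_inv g *v y)"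
proof -
  define h where "h = matrix_inv g"
  have exp: "z = (\<Sum>i\<in>UNIV. (z $ i) *s axis i 1)" for z :: "complex ^ 'n"
    by (simp add: basis_expansion)
  have hexp: "h *v z = (\<Sum>i\<in>UNIV. (z $ i) *s (h *v axis i 1))" for z
    by (subst exp) (simp add: vec.sum vec.scale)
  have "g *v amul \<mu> (h *v x) (h *v y)
      = g *v (\<Sum>i\<in>UNIV. \<Sum>j\<in>UNIV. (x $ i * y $ j) *s amul \<mu> (h *v axis i 1) (h *v axis j 1))"
    unfolding hexp[of x] hexp[of y] amul_sum_left
    by (simp add: amul_sum_right amul_scale_left amul_scale_right vec.scale_sum_right
        mult.commute)
  also have "\<dots> = amul (act g \<mu>) x y"
    unfolding amul_def[of "act g \<mu>"] by (simp add: act_def h_def vec.sum vec.scale)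
  finally show ?thesis by (simp add: h_def)
qed

lemma matrix_inv_cancel:
  fixes g :: "complex ^ 'n ^ 'n"
  assumes "invertible g"
  shows "g *v (matrix_inv g *v x) = x" "matrix_inv g *v (g *v x) = x"
proof -
  have "g ** matrix_inv g = mat 1 \<and> matrix_inv g ** g = mat 1"
    using assms unfolding invertible_def matrix_inv_def by (rule someI_ex)
  then show "g *v (matrix_inv g *v x) = x" "matrix_inv g *v (g *v x) = x"
    by (simp_all add: matrix_vector_mul_assoc)
qed

lemma orbit_iff_isomorphic:
  "\<nu> \<in> orbit \<mu> \<longleftrightarrow>
     (\<exists>f. Vector_Spaces.linear (*s) (*s) f \<and> bij f \<and> (\<forall>x y. f (amul \<mu> x y) = amul \<nu> (f x) (f y)))"
proof
  assume "\<nu> \<in> orbit \<mu>"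
  then obtain g where g: "invertible g" "\<nu> = act g \<mu>" by (auto simp: orbit_def)
  have "bij ((*v) g)" using g(1) matrix_inv_cancel[OF g(1)] by (intro o_bij[of "(*v) (matrix_inv g)"]) auto
  moreover have "g *v amul \<mu> x y = amul \<nu> (g *v x) (g *v y)" for x y
    by (simp add: g amul_act matrix_inv_cancel)
  ultimately show "\<exists>f. Vector_Spaces.linear (*s) (*s) f \<and> bij f \<and>
      (\<forall>x y. f (amul \<mu> x y) = amul \<nu> (f x) (f y))"
    by (intro exI[of _ "(*v) g"]) auto
next
  assume "\<exists>f. Vector_Spaces.linear (*s) (*s) f \<and> bij f \<and>
      (\<forall>x y. f (amul \<mu> x y) = amul \<nu> (f x) (f y))"
  then obtain f where f: "Vector_Spaces.linear (*s) (*s) f" "bij f"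
    "\<And>x y. f (amul \<mu> x y) = amul \<nu> (f x) (f y)" by blast
  define g where "g = matrix f"
  have gf: "g *v x = f x" for x by (simp add: g_def matrix_works[OF f(1)])
  have inv: "invertible g" using f(1,2) invertible_eq_bij[of g] gf by (metis ext)
  have "\<nu> = act g \<mu>"
    by (rule mult_eqI) (simp add: amul_act gf f(3), simp flip: gf add: matrix_inv_cancel[OF inv])
  then show "\<nu> \<in> orbit \<mu>" using inv by (auto simp: orbit_def)
qed


section \<open>The Zariski topology\<close>

inductive polynomial_fun :: "('n::finite mult \<Rightarrow> complex) \<Rightarrow> bool" where
  const: "polynomial_fun (\<lambda>_. c)"
| coord: "polynomial_fun (\<lambda>\<mu>. \<mu> $ i $ j $ k)"
| add: "polynomial_fun p \<Longrightarrow> polynomial_fun q \<Longrightarrow> polynomial_fun (\<lambda>\<mu>. p \<mu> + q \<mu>)"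
| mult: "polynomial_fun p \<Longrightarrow> polynomial_fun q \<Longrightarrow> polynomial_fun (\<lambda>\<mu>. p \<mu> * q \<mu>)"

definition zariski_closed :: "'n::finite mult set \<Rightarrow> bool" where
  "zariski_closed S \<longleftrightarrow>
     (\<exists>P. (\<forall>p\<in>P. polynomial_fun p) \<and> S = {\<mu>. \<forall>p\<in>P. p \<mu> = 0})"

definition zariski :: "'n::finite mult topology" where
  "zariski = topology (\<lambda>U. zariski_closed (- U))"

lemma zariski_closed_Un:
  assumes "zariski_closed S" "zariski_closed T"
  shows "zariski_closed (S \<union> T)"
proof -
  obtain P Q where P: "\<forall>p\<in>P. polynomial_fun p" "S = {\<mu>. \<forall>p\<in>P. p \<mu> = 0}"
    and Q: "\<forall>q\<in>Q. polynomial_fun q" "T = {\<mu>. \<forall>q\<in>Q. q \<mu> = 0}"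
    using assms unfolding zariski_closed_def by blast
  let ?R = "{\<lambda>\<mu>. p \<mu> * q \<mu> |p q. p \<in> P \<and> q \<in> Q}"
  have "\<forall>r\<in>?R. polynomial_fun r" using P(1) Q(1) by (auto intro: polynomial_fun.mult)
  moreover have "S \<union> T = {\<mu>. \<forall>r\<in>?R. r \<mu> = 0}"
    unfolding P(2) Q(2) by (auto; metis mult_eq_0_iff)
  ultimately show ?thesis unfolding zariski_closed_def by blast
qed

lemma zariski_closed_Inter:
  assumes "\<And>S. S \<in> K \<Longrightarrow> zariski_closed S"
  shows "zariski_closed (\<Inter>K)"
proof -
  let ?P = "{p. polynomial_fun p \<and> (\<exists>S\<in>K. \<forall>\<mu>\<in>S. p \<mu> = 0)}"
  have "\<Inter>K = {\<mu>. \<forall>p\<in>?P. p \<mu> = 0}"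
  proof (intro equalityI subsetI)
    fix \<mu> assume \<mu>: "\<mu> \<in> {\<mu>. \<forall>p\<in>?P. p \<mu> = 0}"
    show "\<mu> \<in> \<Inter>K"
    proof
      fix S assume S: "S \<in> K"
      then obtain P where P: "\<forall>p\<in>P. polynomial_fun p" "S = {\<mu>. \<forall>p\<in>P. p \<mu> = 0}"
        using assms unfolding zariski_closed_def by blast
      have "\<forall>\<nu>\<in>S. p \<nu> = 0" if "p \<in> P" for p using that P(2) by simp
      then have "P \<subseteq> ?P" using P(1) S by blast
      then show "\<mu> \<in> S" using \<mu> unfolding P(2) by (simp add: subset_iff)
    qed
  qed blast
  then show ?thesis unfolding zariski_closed_def by (intro exI[of _ ?P]) auto
qed

lemma istopology_zariski: "istopology (\<lambda>U :: 'n::finite mult set. zariski_closed (- U))"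
  unfolding istopology_def
proof (intro conjI allI impI)
  fix S T :: "'n mult set"
  assume "zariski_closed (- S)" "zariski_closed (- T)"
  then show "zariski_closed (- (S \<inter> T))" using zariski_closed_Un by (simp add: Compl_Int)
next
  fix K :: "'n mult set set"
  assume "\<forall>S\<in>K. zariski_closed (- S)"
  then have "zariski_closed (\<Inter>(uminus ` K))" by (intro zariski_closed_Inter) auto
  moreover have "\<Inter>(uminus ` K) = - \<Union>K" by auto
  ultimately show "zariski_closed (- \<Union>K)" by simp
qed

lemma openin_zariski: "openin zariski U \<longleftrightarrow> zariski_closed (- U)"
  by (simp add: zariski_def istopology_zariski)

lemma topspace_zariski [simp]: "topspace zariski = UNIV"
proof -
  have "zariski_closed (- UNIV)"
    unfolding zariski_closed_def
    by (intro exI[of _ "{\<lambda>_. 1}"]) (auto intro: polynomial_fun.const)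
  then show ?thesis by (metis openin_zariski openin_subset top.extremum_uniqueI)
qed

lemma closedin_zariski: "closedin zariski S \<longleftrightarrow> zariski_closed S"
  by (simp add: closedin_def openin_zariski Compl_eq_Diff_UNIV[symmetric])

definition irreducible_in :: "'a topology \<Rightarrow> 'a set \<Rightarrow> bool" where
  "irreducible_in X S \<longleftrightarrow> S \<subseteq> topspace X \<and> S \<noteq> {} \<and>
     (\<forall>A B. closedin X A \<and> closedin X B \<and> S \<subseteq> A \<union> B \<longrightarrow> S \<subseteq> A \<or> S \<subseteq> B)"

definition irreducible_components :: "'a topology \<Rightarrow> 'a set set" where
  "irreducible_components X =
     {S. closedin X S \<and> irreducible_in X S \<and>
         (\<forall>T. closedin X T \<and> irreducible_in X T \<and> S \<subseteq> T \<longrightarrow> T = S)}"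

definition rigid :: "'n::finite mult set \<Rightarrow> 'n mult \<Rightarrow> bool" where
  "rigid X \<mu> \<longleftrightarrow> \<mu> \<in> X \<and> openin (subtopology zariski X) (orbit \<mu>)"

text \<open>Rigid algebras up to isomorphism, an isomorphism class being represented by its orbit.\<close>

definition Rig :: "'n::finite mult set \<Rightarrow> 'n mult set set" where
  "Rig X = {orbit \<mu> |\<mu>. rigid X \<mu>}"


section \<open>The five-dimensional algebras\<close>

text \<open>
  \<open>of_table T\<close> has the products \<open>e\<^sub>i e\<^sub>j = e\<^sub>k\<close> for \<open>(i, j, k) \<in> T\<close> and those forced by
  anticommutativity; all other products of basis vectors vanish. The five elements of the index
  type \<open>5\<close> are written \<open>1, \<dots>, 5\<close> (there \<open>5 = 0\<close>, so these are distinct).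
\<close>

definition of_table :: "('n \<times> 'n \<times> 'n) set \<Rightarrow> 'n::finite mult" where
  "of_table T = (\<chi> i j k. of_bool ((i, j, k) \<in> T) - of_bool ((j, i, k) \<in> T))"

definition g54 :: "5 mult" where
  "g54 = of_table {(1, 2, 3), (1, 3, 4), (2, 3, 5)}"

definition g55 :: "5 mult" where
  "g55 = of_table {(1, 2, 3), (1, 3, 4), (1, 4, 5)}"

definition g56 :: "5 mult" where
  "g56 = of_table {(1, 2, 3), (1, 3, 4), (1, 4, 5), (2, 3, 5)}"

definition M5 :: "5 mult" where
  "M5 = of_table {(1, 2, 4), (3, 4, 5)}"

end

theory Submission
  imports Defs
begin

text \<open>
  A flag of ideals puts a nilpotent Malcev algebra of dimension five in strictly triangular form
  with ten structure constants. The Malcev identity leaves three classes with \<open>dim A\<^sup>2 = 3\<close>, namely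
  \<open>g\<^sub>5\<^sub>,\<^sub>4\<close>, \<open>g\<^sub>5\<^sub>,\<^sub>5\<close>, \<open>g\<^sub>5\<^sub>,\<^sub>6\<close>, and the tables with \<open>A\<^sup>2 \<subseteq> \<langle>e\<^sub>4, e\<^sub>5\<rangle>\<close>. The latter form an affine space
  whose generic, equivalently non-Lie, members are isomorphic to \<open>M\<^sub>5\<close>. The Lie tables reduce
  by a change of basis to another affine space, with generic member \<open>g\<^sub>5\<^sub>,\<^sub>6\<close>. Since a
  polynomial vanishing at all but finitely many points of a line vanishes on it, both affine
  spaces lie in the respective orbit closures; the same argument along a line of matrices shows
  that orbits are irreducible. The rank of the cube \<open>A(AA)\<close>, which is at most one on \<open>M\<^sub>5\<close>, separates
  the components.
\<close>

section \<open>Strictly triangular tables\<close>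

lemma exhaust_5: "(x :: 5) = 1 \<or> x = 2 \<or> x = 3 \<or> x = 4 \<or> x = 5"
proof (induct x)
  case (of_int z)
  \<comment> \<open>Induction over the type \<open>5\<close> runs over the residues 0 to 4; the
    residue 0 is the index written 5.\<close>
  then have "z = 0 \<or> z = 1 \<or> z = 2 \<or> z = 3 \<or> z = 4" by fastforce
  then show ?case by auto
qed

lemma forall_5: "(\<forall>i::5. P i) \<longleftrightarrow> P 1 \<and> P 2 \<and> P 3 \<and> P 4 \<and> P 5"
  by (metis exhaust_5)

lemma UNIV_5: "UNIV = {1, 2, 3, 4, 5 :: 5}"
  using exhaust_5 by auto

lemma sum_5: "sum g (UNIV :: 5 set) = g 1 + g 2 + g 3 + g 4 + g 5"
  unfolding UNIV_5 by (simp add: ac_simps)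

definition vec5 :: "complex \<Rightarrow> complex \<Rightarrow> complex \<Rightarrow> complex \<Rightarrow> complex \<Rightarrow> complex ^ 5" where
  "vec5 x1 x2 x3 x4 x5 =
     (\<chi> i. if i = 1 then x1 else if i = 2 then x2 else if i = 3 then x3 else if i = 4 then x4 else x5)"

lemma vec5_nth [simp]:
  "vec5 x1 x2 x3 x4 x5 $ 1 = x1" "vec5 x1 x2 x3 x4 x5 $ 2 = x2" "vec5 x1 x2 x3 x4 x5 $ 3 = x3"
  "vec5 x1 x2 x3 x4 x5 $ 4 = x4" "vec5 x1 x2 x3 x4 x5 $ 5 = x5"
  by (simp_all add: vec5_def)

text \<open>The letters \<open>a\<close>, \<open>b\<close>, \<open>c\<close>, \<open>d\<close>,
  \<open>f\<close>, \<open>h\<close> stand for the products e1e2, e1e3, e2e3, e1e4, e2e4, e3e4; a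
  digit names the coordinate. For i < j the product e_i e_j involves only basis vectors after e_j,
  so e5 annihilates everything.\<close>

definition tri ::
  "complex \<Rightarrow> complex \<Rightarrow> complex \<Rightarrow> complex \<Rightarrow> complex \<Rightarrow> complex \<Rightarrow> complex \<Rightarrow> complex \<Rightarrow> complex \<Rightarrow> complex
     \<Rightarrow> 5 mult" where
  "tri a3 a4 a5 b4 b5 c4 c5 d f h = (\<chi> i j.
     (of_bool (i = 1 \<and> j = 2) - of_bool (i = 2 \<and> j = 1)) *s vec5 0 0 a3 a4 a5
   + (of_bool (i = 1 \<and> j = 3) - of_bool (i = 3 \<and> j = 1)) *s vec5 0 0 0 b4 b5
   + (of_bool (i = 2 \<and> j = 3) - of_bool (i = 3 \<and> j = 2)) *s vec5 0 0 0 c4 c5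
   + (of_bool (i = 1 \<and> j = 4) - of_bool (i = 4 \<and> j = 1)) *s vec5 0 0 0 0 d
   + (of_bool (i = 2 \<and> j = 4) - of_bool (i = 4 \<and> j = 2)) *s vec5 0 0 0 0 f
   + (of_bool (i = 3 \<and> j = 4) - of_bool (i = 4 \<and> j = 3)) *s vec5 0 0 0 0 h)"

lemma amul_tri:
  "amul (tri a3 a4 a5 b4 b5 c4 c5 d f h) x y = vec5 0 0
     (a3 * (x $ 1 * y $ 2 - x $ 2 * y $ 1))
     (a4 * (x $ 1 * y $ 2 - x $ 2 * y $ 1) + b4 * (x $ 1 * y $ 3 - x $ 3 * y $ 1)
       + c4 * (x $ 2 * y $ 3 - x $ 3 * y $ 2))
     (a5 * (x $ 1 * y $ 2 - x $ 2 * y $ 1) + b5 * (x $ 1 * y $ 3 - x $ 3 * y $ 1)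
       + c5 * (x $ 2 * y $ 3 - x $ 3 * y $ 2) + d * (x $ 1 * y $ 4 - x $ 4 * y $ 1)
       + f * (x $ 2 * y $ 4 - x $ 4 * y $ 2) + h * (x $ 3 * y $ 4 - x $ 4 * y $ 3))"
  by (simp add: amul_def tri_def vec_eq_iff forall_5 sum_5 algebra_simps)

lemma g54_eq_tri: "g54 = tri 1 0 0 1 0 0 1 0 0 0"
  and g55_eq_tri: "g55 = tri 1 0 0 1 0 0 0 1 0 0"
  and g56_eq_tri: "g56 = tri 1 0 0 1 0 0 1 1 0 0"
  and M5_eq_tri: "M5 = tri 0 1 0 0 0 0 0 0 0 1"
  by (simp_all add: g54_def g55_def g56_def M5_def of_table_def tri_def vec_eq_iff forall_5)

section \<open>Isomorphisms and changes of basis\<close>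

lemma invertible_matrix_inv:
  fixes g :: "complex ^ 'n ^ 'n"
  assumes "invertible g"
  shows "invertible (matrix_inv g)"
proof -
  have "g ** matrix_inv g = mat 1 \<and> matrix_inv g ** g = mat 1"
    using assms unfolding invertible_def matrix_inv_def by (rule someI_ex)
  then show ?thesis unfolding invertible_def by blast
qed

lemma orbit_refl [simp]: "\<mu> \<in> orbit \<mu>"
  unfolding orbit_iff_isomorphic by (intro exI[of _ id]) (auto simp: vec.linear_id)

lemma orbit_sym: "\<nu> \<in> orbit \<mu> \<Longrightarrow> \<mu> \<in> orbit \<nu>"
proof -
  assume "\<nu> \<in> orbit \<mu>"
  then obtain g where g: "invertible g" "\<nu> = act g \<mu>" by (auto simp: orbit_def)
  note gi = invertible_matrix_inv[OF g(1)]
  have "matrix_inv (matrix_inv g) *v x = g *v x" for x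
    by (metis matrix_inv_cancel(1)[OF gi] matrix_inv_cancel(1)[OF g(1)] matrix_inv_cancel(2)[OF gi] )
  then have "\<mu> = act (matrix_inv g) \<nu>"
    by (intro mult_eqI) (simp add: amul_act g(2) matrix_inv_cancel[OF g(1)])
  then show ?thesis using gi by (auto simp: orbit_def)
qed

lemma orbit_trans: "\<nu> \<in> orbit \<mu> \<Longrightarrow> \<rho> \<in> orbit \<nu> \<Longrightarrow> \<rho> \<in> orbit \<mu>"
proof -
  assume "\<nu> \<in> orbit \<mu>" "\<rho> \<in> orbit \<nu>"
  then obtain f g where "Vector_Spaces.linear (*s) (*s) f" "bij f"
      "\<forall>x y. f (amul \<mu> x y) = amul \<nu> (f x) (f y)"
      "Vector_Spaces.linear (*s) (*s) g" "bij g"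
      "\<forall>x y. g (amul \<nu> x y) = amul \<rho> (g x) (g y)"
    unfolding orbit_iff_isomorphic by blast
  then show ?thesis unfolding orbit_iff_isomorphic
    by (intro exI[of _ "g \<circ> f"]) (auto intro: Vector_Spaces.linear_compose bij_comp)
qed

lemma orbit_eq_iff: "orbit \<mu> = orbit \<nu> \<longleftrightarrow> \<mu> \<in> orbit \<nu>"
  by (metis orbit_refl orbit_sym orbit_trans subsetI subset_antisym)

lemma orbitE:
  assumes "\<nu> \<in> orbit \<mu>"
  obtains f f' where "Vector_Spaces.linear (*s) (*s) f" "\<And>x. f (f' x) = x" "\<And>x. f' (f x) = x"
    "\<And>x y. amul \<nu> x y = f (amul \<mu> (f' x) (f' y))"
proof -
  obtain g where g: "invertible g" "\<nu> = act g \<mu>" using assms by (auto simp: orbit_def)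
  show thesis
    by (rule that[of "(*v) g" "(*v) (matrix_inv g)"])
      (use g in \<open>simp_all add: matrix_inv_cancel amul_act\<close>)
qed

lemma orbitI_inj:
  assumes lin: "Vector_Spaces.linear (*s) (*s) f" and ker: "\<And>x. f x = 0 \<Longrightarrow> x = 0"
    and hom: "\<And>x y. f (amul \<mu> x y) = amul \<nu> (f x) (f y)"
  shows "\<nu> \<in> orbit \<mu>"
proof -
  have "inj f" using ker vec.linear_inj_iff_eq_0[OF lin] by blast
  then have "bij f" using vec.linear_inj_imp_surj[OF lin] by (simp add: bij_def)
  then show ?thesis unfolding orbit_iff_isomorphic using lin hom by blast
qed

lemma orbitI_surj:
  assumes lin: "Vector_Spaces.linear (*s) (*s) f" and "surj f"
    and hom: "\<And>x y. f (amul \<mu> x y) = amul \<nu> (f x) (f y)"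
  shows "\<nu> \<in> orbit \<mu>"
  using assms vec.linear_surj_imp_inj[OF lin] unfolding orbit_iff_isomorphic bij_def by blast

section \<open>Invariance of the identities under isomorphism\<close>

lemma anticommutative_orbit:
  assumes "\<nu> \<in> orbit \<mu>" "anticommutative \<mu>"
  shows "anticommutative \<nu>"
proof -
  obtain f f' where f: "Vector_Spaces.linear (*s) (*s) f"
    "\<And>x y. amul \<nu> x y = f (amul \<mu> (f' x) (f' y))" using assms(1) orbitE by metis
  show ?thesis using assms(2) unfolding anticommutative_def f(2)
    using vec.linear_neg[OF f(1)] by metis
qed

lemma jacobian_orbit:
  assumes "Vector_Spaces.linear (*s) (*s) f" "\<And>x. f' (f x) = x"
    "\<And>x y. amul \<nu> x y = f (amul \<mu> (f' x) (f' y))"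
  shows "jacobian \<nu> x y z = f (jacobian \<mu> (f' x) (f' y) (f' z))"
  unfolding jacobian_def by (simp add: assms(2,3) vec.linear_add[OF assms(1)])

lemma lie_orbit:
  assumes "\<nu> \<in> orbit \<mu>" "lie \<mu>"
  shows "lie \<nu>"
proof -
  obtain f f' where f: "Vector_Spaces.linear (*s) (*s) f" "\<And>x. f' (f x) = x"
    "\<And>x y. amul \<nu> x y = f (amul \<mu> (f' x) (f' y))" using assms(1) orbitE by metis
  show ?thesis using assms unfolding lie_def
    by (auto intro: anticommutative_orbit simp: jacobian_orbit[OF f] vec.linear_0[OF f(1)])
qed

lemma malcev_orbit:
  assumes "\<nu> \<in> orbit \<mu>" "malcev \<mu>"
  shows "malcev \<nu>"
proof -
  obtain f f' where f: "Vector_Spaces.linear (*s) (*s) f" "\<And>x. f' (f x) = x"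
    "\<And>x y. amul \<nu> x y = f (amul \<mu> (f' x) (f' y))" using assms(1) orbitE by metis
  show ?thesis using assms unfolding malcev_def
    by (auto intro: anticommutative_orbit simp: jacobian_orbit[OF f] f(2,3))
qed

lemma amul_add_left: "amul \<mu> (x + y) z = amul \<mu> x z + amul \<mu> y z"
  and amul_add_right: "amul \<mu> x (y + z) = amul \<mu> x y + amul \<mu> x z"
  by (simp_all add: amul_def vec_eq_iff sum.distrib algebra_simps)

lemma amul_0_left [simp]: "amul \<mu> 0 x = 0" and amul_0_right [simp]: "amul \<mu> x 0 = 0"
  by (simp_all add: amul_def vec_eq_iff)

lemma amul_self:
  assumes "anticommutative \<mu>"
  shows "amul \<mu> x x = 0"
proof -
  have "amul \<mu> x x $ k = - amul \<mu> x x $ k" for k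
    using assms unfolding anticommutative_def by (metis vector_uminus_component)
  then show ?thesis by (simp add: vec_eq_iff)
qed

section \<open>Reading a table off a new basis\<close>

definition comb5 ::
  "complex ^ 5 \<Rightarrow> complex ^ 5 \<Rightarrow> complex ^ 5 \<Rightarrow> complex ^ 5 \<Rightarrow> complex ^ 5 \<Rightarrow> complex ^ 5 \<Rightarrow> complex ^ 5"
  where "comb5 v1 v2 v3 v4 v5 x = x $ 1 *s v1 + x $ 2 *s v2 + x $ 3 *s v3 + x $ 4 *s v4 + x $ 5 *s v5"

lemma linear_comb5: "Vector_Spaces.linear (*s) (*s) (comb5 v1 v2 v3 v4 v5)"
  by unfold_locales (simp_all add: comb5_def vec_eq_iff algebra_simps)

text \<open>By bilinearity it suffices to compare products of basis vectors. Ten of them are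
  hypotheses; anticommutativity supplies the reversed products and the squares.\<close>

lemma comb5_hom:
  assumes anti: "anticommutative \<nu>"
    and p: "amul \<nu> v1 v2 = a3 *s v3 + a4 *s v4 + a5 *s v5"
      "amul \<nu> v1 v3 = b4 *s v4 + b5 *s v5"
      "amul \<nu> v2 v3 = c4 *s v4 + c5 *s v5"
      "amul \<nu> v1 v4 = d *s v5" "amul \<nu> v2 v4 = f *s v5" "amul \<nu> v3 v4 = h *s v5"
      "amul \<nu> v1 v5 = 0" "amul \<nu> v2 v5 = 0" "amul \<nu> v3 v5 = 0" "amul \<nu> v4 v5 = 0"
  shows "comb5 v1 v2 v3 v4 v5 (amul (tri a3 a4 a5 b4 b5 c4 c5 d f h) x y)
       = amul \<nu> (comb5 v1 v2 v3 v4 v5 x) (comb5 v1 v2 v3 v4 v5 y)"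
proof -
  have swap: "amul \<nu> x y = - amul \<nu> y x" for x y
    using anti unfolding anticommutative_def by blast
  have q: "amul \<nu> v2 v1 = - (a3 *s v3 + a4 *s v4 + a5 *s v5)"
      "amul \<nu> v3 v1 = - (b4 *s v4 + b5 *s v5)"
      "amul \<nu> v3 v2 = - (c4 *s v4 + c5 *s v5)"
      "amul \<nu> v4 v1 = - (d *s v5)" "amul \<nu> v4 v2 = - (f *s v5)" "amul \<nu> v4 v3 = - (h *s v5)"
      "amul \<nu> v5 v1 = 0" "amul \<nu> v5 v2 = 0" "amul \<nu> v5 v3 = 0" "amul \<nu> v5 v4 = 0"
    using p by (simp_all add: swap[of v2 v1] swap[of v3 v1] swap[of v3 v2] swap[of v4 v1] swap[of v4 v2] swap[of v4 v3]
        swap[of v5 v1] swap[of v5 v2] swap[of v5 v3] swap[of v5 v4])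
  show ?thesis
    by (simp only: comb5_def amul_add_left amul_add_right amul_scale_left amul_scale_right p q
        amul_self[OF anti])
      (simp add: amul_tri vec_eq_iff algebra_simps)
qed

lemma anticommutative_tri: "anticommutative (tri a3 a4 a5 b4 b5 c4 c5 d f h)"
  unfolding anticommutative_def by (simp add: amul_tri vec_eq_iff forall_5 algebra_simps)

text \<open>The form of every explicit change of basis between tables below: \<open>v1\<close> to
  \<open>v5\<close> are the new basis vectors in old coordinates, and the first premise is their
  linear independence.\<close>

lemma tri_orbitI:
  assumes "\<And>x. comb5 v1 v2 v3 v4 v5 x = 0 \<Longrightarrow> x = 0"
    and "amul (tri p1 p2 p3 p4 p5 p6 p7 p8 p9 p10) v1 v2 = a3 *s v3 + a4 *s v4 + a5 *s v5"
      "amul (tri p1 p2 p3 p4 p5 p6 p7 p8 p9 p10) v1 v3 = b4 *s v4 + b5 *s v5"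
      "amul (tri p1 p2 p3 p4 p5 p6 p7 p8 p9 p10) v2 v3 = c4 *s v4 + c5 *s v5"
      "amul (tri p1 p2 p3 p4 p5 p6 p7 p8 p9 p10) v1 v4 = d *s v5"
      "amul (tri p1 p2 p3 p4 p5 p6 p7 p8 p9 p10) v2 v4 = f *s v5"
      "amul (tri p1 p2 p3 p4 p5 p6 p7 p8 p9 p10) v3 v4 = h *s v5"
      "amul (tri p1 p2 p3 p4 p5 p6 p7 p8 p9 p10) v1 v5 = 0"
      "amul (tri p1 p2 p3 p4 p5 p6 p7 p8 p9 p10) v2 v5 = 0"
      "amul (tri p1 p2 p3 p4 p5 p6 p7 p8 p9 p10) v3 v5 = 0"
      "amul (tri p1 p2 p3 p4 p5 p6 p7 p8 p9 p10) v4 v5 = 0"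
  shows "tri p1 p2 p3 p4 p5 p6 p7 p8 p9 p10 \<in> orbit (tri a3 a4 a5 b4 b5 c4 c5 d f h)"
  using orbitI_inj[OF linear_comb5 assms(1) comb5_hom[OF anticommutative_tri assms(2-)]] by blast

section \<open>Tables with A^2 inside the span of e4 and e5\<close>

lemma tri_cyclic:
  "tri 0 a4 a5 b4 b5 c4 c5 d f h \<in> orbit (tri 0 c4 c5 (-a4) (-a5) (-b4) (-b5) f h d)"
  by (rule tri_orbitI[of "vec5 0 1 0 0 0" "vec5 0 0 1 0 0" "vec5 1 0 0 0 0" "vec5 0 0 0 1 0" "vec5 0 0 0 0 1"])
    (simp_all add: comb5_def amul_tri vec_eq_iff forall_5)

text \<open>Replacing e2 and e3 by e2 - s e1 and e3 - t e1 keeps their products with e1, while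
  \<open>f\<close> and \<open>h\<close> change by multiples of \<open>d\<close>.\<close>

lemma tri_shear:
  "tri 0 a4 a5 b4 b5 c4 c5 d f h
     \<in> orbit (tri 0 a4 a5 b4 b5 (c4 - s * b4 + t * a4) (c5 - s * b5 + t * a5) d (f - s * d) (h - t * d))"
  by (rule tri_orbitI[of "vec5 1 0 0 0 0" "vec5 (-s) 1 0 0 0" "vec5 (-t) 0 1 0 0" "vec5 0 0 0 1 0" "vec5 0 0 0 0 1"])
    (simp_all add: comb5_def amul_tri vec_eq_iff forall_5 algebra_simps)

text \<open>Cyclic permutation of the first three basis vectors makes \<open>d \<noteq> 0\<close>; a shear then clears
  \<open>f\<close> and \<open>h\<close>.\<close>

lemma tri_normalize_action:
  assumes "d \<noteq> 0 \<or> f \<noteq> 0 \<or> h \<noteq> 0"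
  shows "\<exists>a4' a5' b4' b5' c4' c5' d'. d' \<noteq> 0
    \<and> tri 0 a4 a5 b4 b5 c4 c5 d f h \<in> orbit (tri 0 a4' a5' b4' b5' c4' c5' d' 0 0)"
proof -
  have main: "\<exists>a4' a5' b4' b5' c4' c5' d'. d' \<noteq> 0
      \<and> tri 0 a4 a5 b4 b5 c4 c5 d f h \<in> orbit (tri 0 a4' a5' b4' b5' c4' c5' d' 0 0)"
    if "d \<noteq> 0" for a4 a5 b4 b5 c4 c5 d f h
    using tri_shear[of a4 a5 b4 b5 c4 c5 d f h "f / d" "h / d"] that by simp blast
  \<comment> \<open>One rotation brings \<open>f\<close> into the place of \<open>d\<close>, two
    bring \<open>h\<close> there.\<close>
  note c = tri_cyclic[of a4 a5 b4 b5 c4 c5 d f h]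
  note c2 = orbit_trans[OF tri_cyclic c]
  consider "d \<noteq> 0" | "f \<noteq> 0" | "h \<noteq> 0" using assms by blast
  then show ?thesis
  proof cases
    case 1
    then show ?thesis by (rule main)
  next
    case 2
    then show ?thesis using main[OF 2] c orbit_trans by meson
  next
    case 3
    then show ?thesis using main[OF 3] c2 orbit_trans by meson
  qed
qed

text \<open>The Jacobian is alternating with values in the line of e5. Among basis triples only
  J(e1,e2,e3) and J(e1,e2,e4) can be nonzero; each is multiplied by the 3x3 minor of the
  corresponding coordinates.\<close>

lemma jacobian_tri:
  "jacobian (tri a3 a4 a5 b4 b5 c4 c5 d f h) x y z = vec5 0 0 0 0
     ((b4 * f - c4 * d - a4 * h) *
        (x $ 1 * (y $ 2 * z $ 3 - y $ 3 * z $ 2) - x $ 2 * (y $ 1 * z $ 3 - y $ 3 * z $ 1)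
          + x $ 3 * (y $ 1 * z $ 2 - y $ 2 * z $ 1))
      + a3 * h *
        (x $ 1 * (y $ 2 * z $ 4 - y $ 4 * z $ 2) - x $ 2 * (y $ 1 * z $ 4 - y $ 4 * z $ 1)
          + x $ 4 * (y $ 1 * z $ 2 - y $ 2 * z $ 1)))"
  unfolding jacobian_def by (simp add: amul_tri vec_eq_iff forall_5 algebra_simps)

lemma lie_tri_iff:
  "lie (tri 0 a4 a5 b4 b5 c4 c5 d f h) \<longleftrightarrow> b4 * f - c4 * d - a4 * h = 0"
proof
  assume "lie (tri 0 a4 a5 b4 b5 c4 c5 d f h)"
  then have "jacobian (tri 0 a4 a5 b4 b5 c4 c5 d f h)
      (vec5 1 0 0 0 0) (vec5 0 1 0 0 0) (vec5 0 0 1 0 0) = 0"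
    unfolding lie_def by blast
  then show "b4 * f - c4 * d - a4 * h = 0"
    by (simp add: jacobian_tri vec_eq_iff forall_5)
qed (simp add: lie_def anticommutative_tri jacobian_tri vec_eq_iff forall_5)

text \<open>Jacobians are multiples of e5, which annihilates the algebra, so the Malcev identity
  reduces to J(x, y, xz) = 0. It is evaluated on basis vectors.\<close>

lemma malcev_triD:
  assumes "malcev (tri a3 a4 a5 b4 b5 c4 c5 d f h)"
  shows "a3 * (b4 * h) = 0" "a3 * (c4 * h) = 0" "a3 * (b4 * f - c4 * d) = 0"
proof -
  let ?m = "tri a3 a4 a5 b4 b5 c4 c5 d f h"
  have m: "jacobian ?m x y (amul ?m x z) = amul ?m (jacobian ?m x y z) x" for x y z
    using assms unfolding malcev_def by blast
  note s = jacobian_def amul_tri vec_eq_iff forall_5 algebra_simps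
  show "a3 * (b4 * h) = 0"
    using m[of "vec5 1 0 0 0 0" "vec5 0 1 0 0 0" "vec5 0 0 1 0 0"] by (simp add: s)
  show "a3 * (c4 * h) = 0"
    using m[of "vec5 0 1 0 0 0" "vec5 1 0 0 0 0" "vec5 0 0 1 0 0"] by (simp add: s)
  \<comment> \<open>For x = e1 and y = z = e2 the term a4 J(e1,e2,e4) cancels the part of a3
    J(e1,e2,e3) that contains \<open>h\<close>.\<close>
  show "a3 * (b4 * f - c4 * d) = 0"
    using m[of "vec5 1 0 0 0 0" "vec5 0 1 0 0 0" "vec5 0 1 0 0 0"] by (simp add: s)
qed

lemma tri_in_orbit_M5:
  assumes "c4 \<noteq> 0" "d \<noteq> 0"
  shows "tri 0 a4 a5 b4 b5 c4 c5 d 0 0 \<in> orbit M5"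
proof -
  \<comment> \<open>The places of e1, e2, e3 in \<open>M5\<close> go to modifications of e2, e3, e1.
    The scalars \<open>s\<close>, \<open>t\<close> remove the e4 parts, and \<open>u\<close>,
    \<open>v\<close> the e5 parts, of the first two new vectors times the third.\<close>
  define s t where "s = - b4 / c4" and "t = a4 / c4"
  define u v where "u = (t * c5 - a5) / d" and "v = - (s * c5 + b5) / d"
  have st: "b4 = - s * c4" "a4 = t * c4" using assms by (simp_all add: s_def t_def)
  have uv: "a5 = t * c5 - u * d" "b5 = - s * c5 - v * d"
    using assms by (simp_all add: u_def v_def field_simps)
  show ?thesis unfolding M5_eq_tri st uv
    by (rule tri_orbitI[of "vec5 0 1 0 u 0" "vec5 0 0 1 v 0" "vec5 1 s t 0 0" "vec5 0 0 0 c4 c5"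
          "vec5 0 0 0 0 (d * c4)"])
      (use assms in \<open>auto simp: comb5_def amul_tri vec_eq_iff forall_5 algebra_simps\<close>)
qed

text \<open>A nonzero Jacobian forces one of \<open>d\<close>, \<open>f\<close>, \<open>h\<close> to
  be nonzero. After normalization to \<open>f\<close> = \<open>h\<close> = 0 its coefficient is -
  \<open>c4'\<close> * \<open>d'\<close>, so \<open>c4'\<close> is nonzero too.\<close>

lemma not_lie_in_orbit_M5:
  assumes "\<not> lie (tri 0 a4 a5 b4 b5 c4 c5 d f h)"
  shows "tri 0 a4 a5 b4 b5 c4 c5 d f h \<in> orbit M5"
proof -
  have "d \<noteq> 0 \<or> f \<noteq> 0 \<or> h \<noteq> 0" using assms by (auto simp: lie_tri_iff)
  then obtain a4' a5' b4' b5' c4' c5' d' where d': "d' \<noteq> 0"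
    and o: "tri 0 a4 a5 b4 b5 c4 c5 d f h \<in> orbit (tri 0 a4' a5' b4' b5' c4' c5' d' 0 0)"
    using tri_normalize_action by meson
  have "c4' \<noteq> 0" using assms lie_orbit[OF o] by (auto simp: lie_tri_iff)
  then show ?thesis using tri_in_orbit_M5 d' o orbit_trans by blast
qed

text \<open>If \<open>d\<close>, \<open>f\<close>, \<open>h\<close> are not all zero, the normalized
  Lie condition is \<open>c4'\<close> * \<open>d'\<close> = 0. If all vanish, a shear removes
  \<open>c4\<close> when \<open>b4\<close> is nonzero; otherwise a rotation moves the zero
  \<open>b4\<close> into the place of \<open>c4\<close>.\<close>

lemma lie_tri_normal_form:
  assumes "lie (tri 0 a4 a5 b4 b5 c4 c5 d f h)"
  shows "\<exists>a4' a5' b4' b5' c5' d'.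
    tri 0 a4 a5 b4 b5 c4 c5 d f h \<in> orbit (tri 0 a4' a5' b4' b5' 0 c5' d' 0 0)"
proof (cases "d = 0 \<and> f = 0 \<and> h = 0")
  case True
  show ?thesis
  proof (cases "b4 = 0")
    case b4: True
    show ?thesis using tri_cyclic[of a4 a5 b4 b5 c4 c5 d f h] True b4 by simp blast
  next
    case False
    show ?thesis using tri_shear[of a4 a5 b4 b5 c4 c5 d f h "c4 / b4" 0] True False by simp blast
  qed
next
  case False
  then obtain a4' a5' b4' b5' c4' c5' d' where d': "d' \<noteq> 0"
    and o: "tri 0 a4 a5 b4 b5 c4 c5 d f h \<in> orbit (tri 0 a4' a5' b4' b5' c4' c5' d' 0 0)"
    using tri_normalize_action by meson
  have "c4' = 0" using d' lie_orbit[OF orbit_sym[OF o] assms] by (auto simp: lie_tri_iff)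
  then show ?thesis using o by blast
qed

section \<open>Tables with e1e2 outside the span of e4 and e5\<close>

lemma tri_in_orbit_g56:
  assumes "a3 \<noteq> 0" "b4 \<noteq> 0" "c5 \<noteq> 0" "d \<noteq> 0"
  shows "tri a3 a4 a5 b4 b5 0 c5 d 0 0 \<in> orbit g56"
proof -
  \<comment> \<open>Both e1 and e2 are scaled by \<open>c\<close>, and v3 = v1v2, v4 = v1v3, v5 =
    v1v4. The remaining relation v2v3 = v5 equates c^3 a3 c5 with c^4 a3 b4 d, which determines
    \<open>c\<close>.\<close>
  define c where "c = c5 / (b4 * d)"
  have c5: "c5 = c * b4 * d" and "c \<noteq> 0" using assms by (simp_all add: c_def)
  then show ?thesis unfolding g56_eq_tri c5
    by (intro tri_orbitI[of "vec5 c 0 0 0 0" "vec5 0 c 0 0 0" "vec5 0 0 (c^2 * a3) (c^2 * a4) (c^2 * a5)"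
          "vec5 0 0 0 (c^3 * a3 * b4) (c^3 * (a3 * b5 + a4 * d))" "vec5 0 0 0 0 (c^4 * a3 * b4 * d)"])
      (use assms in \<open>auto simp: comb5_def amul_tri vec_eq_iff forall_5 power_numeral_reduce algebra_simps\<close>)
qed

lemma tri_swap:
  "tri a3 a4 a5 b4 b5 c4 c5 d f h \<in> orbit (tri a3 a4 a5 c4 c5 (-b4) (-b5) f (-d) h)"
  by (rule tri_orbitI[of "vec5 0 1 0 0 0" "vec5 (-1) 0 0 0 0" "vec5 0 0 1 0 0" "vec5 0 0 0 1 0" "vec5 0 0 0 0 1"])
    (simp_all add: comb5_def amul_tri vec_eq_iff forall_5)

text \<open>The last premise makes (c4, f) a multiple of (b4, d), so replacing e2 by e2 - s e1
  clears both entries at once. The new e3 and e4 are successive products with e1.\<close>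

lemma tri_two_generated:
  assumes "a3 \<noteq> 0" "b4 \<noteq> 0" "b4 * f = c4 * d"
  shows "tri a3 a4 a5 b4 b5 c4 c5 d f 0
    \<in> orbit (tri 1 0 0 1 0 0 (a3 * (c5 - c4 / b4 * b5)) (a3 * b4 * d) 0 0)"
proof -
  define s where "s = c4 / b4"
  have c4: "c4 = s * b4" and f: "f = s * d" using assms by (simp_all add: s_def field_simps)
  show ?thesis unfolding s_def[symmetric] unfolding c4 f
    by (rule tri_orbitI[of "vec5 1 0 0 0 0" "vec5 (-s) 1 0 0 0" "vec5 0 0 a3 a4 a5"
          "vec5 0 0 0 (a3 * b4) (a3 * b5 + a4 * d)" "vec5 0 0 0 0 1"])
      (use assms in \<open>auto simp: comb5_def amul_tri vec_eq_iff forall_5 algebra_simps\<close>)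
qed

lemma tri_two_generated_cases:
  "tri 1 0 0 1 0 0 c d 0 0 \<in> orbit g54 \<union> orbit g55 \<union> orbit g56 \<union> orbit (tri 0 1 0 0 0 0 0 1 0 0)"
proof -
  note s = comb5_def amul_tri vec_eq_iff forall_5 algebra_simps
  consider "c = 0" "d = 0" | "c = 0" "d \<noteq> 0" | "c \<noteq> 0" "d = 0" | "c \<noteq> 0" "d \<noteq> 0" by blast
  then show ?thesis
  proof cases
    case 1
    \<comment> \<open>Here e5 spans a direct summand and A^2 is spanned by e3 and e4, which move to
      the last two places.\<close>
    have "tri 1 0 0 1 0 0 c d 0 0 \<in> orbit (tri 0 1 0 0 0 0 0 1 0 0)"
      by (rule tri_orbitI[of "vec5 1 0 0 0 0" "vec5 0 1 0 0 0" "vec5 0 0 0 0 1" "vec5 0 0 1 0 0"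
            "vec5 0 0 0 1 0"]) (use 1 in \<open>auto simp: s\<close>)
    then show ?thesis by blast
  next
    case 2
    have "tri 1 0 0 1 0 0 c d 0 0 \<in> orbit g55" unfolding g55_eq_tri
      by (rule tri_orbitI[of "vec5 1 0 0 0 0" "vec5 0 1 0 0 0" "vec5 0 0 1 0 0" "vec5 0 0 0 1 0"
            "vec5 0 0 0 0 d"]) (use 2 in \<open>auto simp: s\<close>)
    then show ?thesis by blast
  next
    case 3
    have "tri 1 0 0 1 0 0 c d 0 0 \<in> orbit g54" unfolding g54_eq_tri
      by (rule tri_orbitI[of "vec5 1 0 0 0 0" "vec5 0 1 0 0 0" "vec5 0 0 1 0 0" "vec5 0 0 0 1 0"
            "vec5 0 0 0 0 c"]) (use 3 in \<open>auto simp: s\<close>)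
    then show ?thesis by blast
  next
    case 4
    then show ?thesis using tri_in_orbit_g56[of 1 1 c d 0 0 0] by simp
  qed
qed

text \<open>Up to isomorphism, the nilpotent anticommutative algebras with \<open>dim A\<^sup>2 \<le> 2\<close>.\<close>

definition flat :: "5 mult set" where
  "flat = {\<mu>. \<exists>a4 a5 b4 b5 c4 c5 d f h. \<mu> \<in> orbit (tri 0 a4 a5 b4 b5 c4 c5 d f h)}"

lemma flatI: "\<mu> \<in> orbit (tri 0 a4 a5 b4 b5 c4 c5 d f h) \<Longrightarrow> \<mu> \<in> flat"
  unfolding flat_def by blast

lemma flatE:
  assumes "\<mu> \<in> flat"
  obtains a4 a5 b4 b5 c4 c5 d f h where "\<mu> \<in> orbit (tri 0 a4 a5 b4 b5 c4 c5 d f h)"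
  using assms unfolding flat_def mem_Collect_eq by (elim exE) (rule that)

lemma flat_orbit:
  assumes "\<mu> \<in> orbit \<nu>" "\<nu> \<in> flat"
  shows "\<mu> \<in> flat"
  using assms(2) by (rule flatE) (rule flatI[OF orbit_trans[OF _ assms(1)]])

text \<open>If \<open>a3\<close> = 0 or \<open>b4\<close> = \<open>c4\<close> = 0, then A^2 has
  dimension at most two. Otherwise, up to swapping e1 and e2, \<open>b4\<close> is nonzero, and the
  Malcev conditions yield h = 0 and b4 f = c4 d.\<close>

lemma malcev_tri_cases:
  assumes "malcev (tri a3 a4 a5 b4 b5 c4 c5 d f h)"
  shows "tri a3 a4 a5 b4 b5 c4 c5 d f h \<in> orbit g54 \<union> orbit g55 \<union> orbit g56 \<union> flat"
proof -
  have trans: "\<mu> \<in> orbit g54 \<union> orbit g55 \<union> orbit g56 \<union> flat"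
    if "\<mu> \<in> orbit \<nu>" "\<nu> \<in> orbit g54 \<union> orbit g55 \<union> orbit g56 \<union> flat" for \<mu> \<nu>
    using that orbit_trans[OF _ that(1)] flat_orbit[OF that(1)] by blast
  have main: "tri a3 a4 a5 b4 b5 c4 c5 d f h \<in> orbit g54 \<union> orbit g55 \<union> orbit g56 \<union> flat"
    if "malcev (tri a3 a4 a5 b4 b5 c4 c5 d f h)" "a3 \<noteq> 0" "b4 \<noteq> 0" for a3 a4 a5 b4 b5 c4 c5 d f h
  proof -
    have h: "h = 0" and bf: "b4 * f = c4 * d" using malcev_triD[OF that(1)] that(2,3) by auto
    have "tri 1 0 0 1 0 0 c' d' 0 0 \<in> orbit g54 \<union> orbit g55 \<union> orbit g56 \<union> flat" for c' d'
      using tri_two_generated_cases[of c' d'] flatI by fast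
    then show ?thesis unfolding h by (rule trans[OF tri_two_generated[OF that(2,3) bf]])
  qed
  consider "a3 = 0" | "a3 \<noteq> 0" "b4 = 0" "c4 = 0" | "a3 \<noteq> 0" "b4 \<noteq> 0" | "a3 \<noteq> 0" "c4 \<noteq> 0" by blast
  then show ?thesis
  proof cases
    case 1
    then show ?thesis using flatI[OF orbit_refl] by simp
  next
    case 2
    \<comment> \<open>A^2 lies in the span of e1e2 and e5, so e1e2 takes the fourth place and the
      old e4 the third.\<close>
    have "tri a3 a4 a5 b4 b5 c4 c5 d f h
        \<in> orbit (tri 0 1 0 0 d 0 f (a3 * b5 + a4 * d) (a3 * c5 + a4 * f) (- a3 * h))"
      by (rule tri_orbitI[of "vec5 1 0 0 0 0" "vec5 0 1 0 0 0" "vec5 0 0 0 1 0" "vec5 0 0 a3 a4 a5"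
            "vec5 0 0 0 0 1"])
        (use 2 in \<open>auto simp: comb5_def amul_tri vec_eq_iff forall_5 algebra_simps\<close>)
    from flatI[OF this] show ?thesis by simp
  next
    case 3
    then show ?thesis using main assms by blast
  next
    case 4
    note sw = tri_swap[of a3 a4 a5 b4 b5 c4 c5 d f h]
    show ?thesis by (rule trans[OF sw main[OF malcev_orbit[OF orbit_sym[OF sw] assms] 4]])
  qed
qed

section \<open>Nilpotency and adapted bases\<close>

lemma amul_alg_power:
  assumes "k \<ge> 1" "y \<in> alg_power \<mu> k"
  shows "amul \<mu> x y \<in> alg_power \<mu> (Suc k)"
proof -
  have "x \<in> alg_power \<mu> 1" by (simp add: alg_power.simps)
  then have "amul \<mu> x y \<in> (\<Union>i\<in>{0<..<Suc k}.
      {amul \<mu> x y |x y. x \<in> alg_power \<mu> i \<and> y \<in> alg_power \<mu> (Suc k - i)})"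
    using assms by (intro UN_I[of 1]) auto
  then show ?thesis using assms(1) unfolding alg_power.simps[of \<mu> "Suc k"]
    by (auto intro: vec.span_base)
qed

text \<open>A subspace with AW = W stays inside every power of A, one of which is zero.\<close>

lemma nilpotent_span_proper:
  assumes "nilpotent \<mu>" "vec.span {amul \<mu> x w |x w. w \<in> W} = W"
  shows "W \<subseteq> {0}"
proof -
  obtain k where k: "k \<ge> 1" "alg_power \<mu> k = {0}" using assms(1) unfolding nilpotent_def by blast
  have "W \<subseteq> alg_power \<mu> (Suc n)" for n
  proof (induction n)
    case 0
    then show ?case by (simp add: alg_power.simps)
  next
    case (Suc n)
    have "vec.subspace (alg_power \<mu> (Suc (Suc n)))"
      by (subst alg_power.simps) (simp add: vec.subspace_span)
    moreover have "{amul \<mu> x w |x w. w \<in> W} \<subseteq> alg_power \<mu> (Suc (Suc n))"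
      using Suc amul_alg_power[of "Suc n" _ \<mu>] by auto
    ultimately show ?case by (subst assms(2)[symmetric]) (rule vec.span_minimal[rotated])
  qed
  from this[of "k - 1"] k show ?thesis by simp
qed

text \<open>A basis of \<open>U\<close> extends to one of \<open>W\<close>; dropping an added vector
  \<open>w\<close> leaves a basis of \<open>H\<close>.\<close>

lemma hyperplane_between:
  fixes U W :: "(complex ^ 'n) set"
  assumes U: "vec.subspace U" and W: "vec.subspace W" and UW: "U \<subset> W"
  obtains w H where "vec.subspace H" "U \<subseteq> H" "H \<subseteq> W" "vec.dim W = Suc (vec.dim H)" "w \<in> W"
    "\<And>v. v \<in> W \<Longrightarrow> \<exists>c. v - c *s w \<in> H"
proof -
  obtain B where B: "B \<subseteq> U" "vec.independent B" "U \<subseteq> vec.span B"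
    by (rule vec.basis_exists[of U])
  obtain C where C: "B \<subseteq> C" "C \<subseteq> W" "vec.independent C" "W \<subseteq> vec.span C"
    by (rule vec.maximal_independent_subset_extend[of B W]) (use B UW in auto)
  have "vec.span B = U" using B U by (intro subset_antisym vec.span_minimal)
  moreover have sC: "vec.span C = W" using C W by (intro subset_antisym vec.span_minimal)
  ultimately have "B \<noteq> C" using UW by blast
  then obtain w where w: "w \<in> C" "w \<notin> B" using C(1) by blast
  have ins: "insert w (C - {w}) = C" using w by blast
  have ind: "vec.independent (C - {w})" by (rule vec.independent_mono[OF C(3)]) blast
  have fin: "finite C" by (rule vec.finiteI_independent[OF C(3)])
  show thesis
  proof (rule that[of "vec.span (C - {w})" w])
    show "U \<subseteq> vec.span (C - {w})"
      using B(3) vec.span_mono[of B "C - {w}"] C(1) w by blast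
    show "vec.span (C - {w}) \<subseteq> W" using sC vec.span_mono[of "C - {w}" C] by blast
    show "vec.dim W = Suc (vec.dim (vec.span (C - {w})))"
      using vec.dim_span_eq_card_independent[OF C(3)] sC vec.dim_span_eq_card_independent[OF ind]
        card_Suc_Diff1[OF fin w(1)] by simp
    show "w \<in> W" using w C by blast
    show "\<exists>c. v - c *s w \<in> vec.span (C - {w})" if "v \<in> W" for v
      using that sC vec.span_breakdown_eq[of v w "C - {w}"] ins by auto
  qed auto
qed

text \<open>One step of the flag: AW is proper in \<open>W\<close>, so some hyperplane
  \<open>H\<close> of \<open>W\<close> contains it. \<open>H\<close> is again stable, since AH lies
  in AW.\<close>

lemma nilpotent_hyperplane:
  fixes W :: "(complex ^ 'n) set"
  assumes nil: "nilpotent \<mu>" and W: "vec.subspace W" and dim: "vec.dim W = Suc n"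
    and inv: "\<And>x w. w \<in> W \<Longrightarrow> amul \<mu> x w \<in> W"
  obtains w H where "vec.subspace H" "H \<subseteq> W" "vec.dim H = n" "w \<in> W"
    "\<And>v. v \<in> W \<Longrightarrow> \<exists>c. v - c *s w \<in> H" "\<And>x v. v \<in> W \<Longrightarrow> amul \<mu> x v \<in> H"
proof -
  define U where "U = vec.span {amul \<mu> x w |x w. w \<in> W}"
  have "U \<subseteq> W" unfolding U_def using inv W by (intro vec.span_minimal) auto
  moreover have "U \<noteq> W"
    using nilpotent_span_proper[OF nil, of W] dim vec.dim_eq_0[of W] unfolding U_def by linarith
  ultimately have "U \<subset> W" by blast
  then obtain w H where wH: "vec.subspace H" "U \<subseteq> H" "H \<subseteq> W" "vec.dim W = Suc (vec.dim H)" "w \<in> W"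
      "\<And>v. v \<in> W \<Longrightarrow> \<exists>c. v - c *s w \<in> H"
    by (rule hyperplane_between[rotated 2]) (auto simp: U_def W)
  have "amul \<mu> x v \<in> H" if "v \<in> W" for x v
    using wH(2) that unfolding U_def by (auto intro: vec.span_base)
  with wH dim show thesis by (intro that[of H w]) simp_all
qed

text \<open>The flag satisfies A F_i in F_(i+1), and e_i spans F_i modulo F_(i+1). Hence e_i e_j
  lies in F_(j+1), which is strict triangularity.\<close>

lemma nilpotent_orbit_tri:
  fixes \<mu> :: "5 mult"
  assumes nil: "nilpotent \<mu>" and anti: "anticommutative \<mu>"
  obtains a3 a4 a5 b4 b5 c4 c5 d f h where "\<mu> \<in> orbit (tri a3 a4 a5 b4 b5 c4 c5 d f h)"
proof -
  have dim: "vec.dim (UNIV :: (complex ^ 5) set) = Suc (Suc (Suc (Suc (Suc 0))))"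
    by (subst vec_dim_card) simp
  obtain e1 F2 where F2: "vec.subspace F2" "F2 \<subseteq> UNIV" "vec.dim F2 = Suc (Suc (Suc (Suc 0)))" "e1 \<in> UNIV"
      "\<And>v. v \<in> UNIV \<Longrightarrow> \<exists>c. v - c *s e1 \<in> F2" "\<And>x v. v \<in> UNIV \<Longrightarrow> amul \<mu> x v \<in> F2"
    by (rule nilpotent_hyperplane[OF nil vec.subspace_UNIV dim UNIV_I]) (rule that)
  obtain e2 F3 where F3: "vec.subspace F3" "F3 \<subseteq> F2" "vec.dim F3 = Suc (Suc (Suc 0))" "e2 \<in> F2"
      "\<And>v. v \<in> F2 \<Longrightarrow> \<exists>c. v - c *s e2 \<in> F3" "\<And>x v. v \<in> F2 \<Longrightarrow> amul \<mu> x v \<in> F3"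
    by (rule nilpotent_hyperplane[OF nil F2(1,3)]) (use F2(6) in simp_all)
  obtain e3 F4 where F4: "vec.subspace F4" "F4 \<subseteq> F3" "vec.dim F4 = Suc (Suc 0)" "e3 \<in> F3"
      "\<And>v. v \<in> F3 \<Longrightarrow> \<exists>c. v - c *s e3 \<in> F4" "\<And>x v. v \<in> F3 \<Longrightarrow> amul \<mu> x v \<in> F4"
    by (rule nilpotent_hyperplane[OF nil F3(1,3)])
      (use F3(6) subsetD[OF F3(2)] in simp_all)
  obtain e4 F5 where F5: "vec.subspace F5" "F5 \<subseteq> F4" "vec.dim F5 = Suc 0" "e4 \<in> F4"
      "\<And>v. v \<in> F4 \<Longrightarrow> \<exists>c. v - c *s e4 \<in> F5" "\<And>x v. v \<in> F4 \<Longrightarrow> amul \<mu> x v \<in> F5"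
    by (rule nilpotent_hyperplane[OF nil F4(1,3)]) (use F4(6) subsetD[OF F4(2)] in simp_all)
  obtain e5 F6 where F6: "vec.subspace F6" "F6 \<subseteq> F5" "vec.dim F6 = 0" "e5 \<in> F5"
      "\<And>v. v \<in> F5 \<Longrightarrow> \<exists>c. v - c *s e5 \<in> F6" "\<And>x v. v \<in> F5 \<Longrightarrow> amul \<mu> x v \<in> F6"
    by (rule nilpotent_hyperplane[OF nil F5(1,3)]) (use F5(6) subsetD[OF F5(2)] in simp_all)
  have F6_0: "F6 \<subseteq> {0}" using F6(3) by simp
  have F5_comb: "\<exists>c. v = c *s e5" if "v \<in> F5" for v
    using F6(5)[OF that] F6_0 by auto
  have F4_comb: "\<exists>b c. v = b *s e4 + c *s e5" if v: "v \<in> F4" for v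
  proof -
    obtain b where "v - b *s e4 \<in> F5" using F5(5)[OF v] by blast
    then obtain c where "v - b *s e4 = c *s e5" using F5_comb by blast
    then show ?thesis by (intro exI[of _ b] exI[of _ c]) (simp add: algebra_simps)
  qed
  have F3_comb: "\<exists>a b c. v = a *s e3 + b *s e4 + c *s e5" if v: "v \<in> F3" for v
  proof -
    obtain a where "v - a *s e3 \<in> F4" using F4(5)[OF v] by blast
    then obtain b c where "v - a *s e3 = b *s e4 + c *s e5" using F4_comb by blast
    then show ?thesis by (intro exI[of _ a] exI[of _ b] exI[of _ c]) (simp add: algebra_simps)
  qed
  have F2_comb: "\<exists>a b c d. v = a *s e2 + b *s e3 + c *s e4 + d *s e5" if v: "v \<in> F2" for v
  proof -
    obtain a where "v - a *s e2 \<in> F3" using F3(5)[OF v] by blast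
    then obtain b c d where "v - a *s e2 = b *s e3 + c *s e4 + d *s e5" using F3_comb by blast
    then show ?thesis by (intro exI[of _ a] exI[of _ b] exI[of _ c] exI[of _ d]) (simp add: algebra_simps)
  qed
  \<comment> \<open>In dimension five, spanning vectors form a basis, so surjectivity suffices for
    an isomorphism.\<close>
  have "surj (comb5 e1 e2 e3 e4 e5)"
    unfolding surj_def
  proof
    fix v
    obtain a where "v - a *s e1 \<in> F2" using F2(5)[OF UNIV_I] by blast
    then obtain b c d e where "v - a *s e1 = b *s e2 + c *s e3 + d *s e4 + e *s e5"
      using F2_comb by blast
    then show "\<exists>x. v = comb5 e1 e2 e3 e4 e5 x"
      by (intro exI[of _ "vec5 a b c d e"]) (simp add: comb5_def algebra_simps)
  qed
  moreover obtain a3 a4 a5 where "amul \<mu> e1 e2 = a3 *s e3 + a4 *s e4 + a5 *s e5"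
    using F3(4,6) F3_comb by blast
  moreover obtain b4 b5 where "amul \<mu> e1 e3 = b4 *s e4 + b5 *s e5" using F4(4,6) F4_comb by blast
  moreover obtain c4 c5 where "amul \<mu> e2 e3 = c4 *s e4 + c5 *s e5" using F4(4,6) F4_comb by blast
  moreover obtain d where "amul \<mu> e1 e4 = d *s e5" using F5(4,6) F5_comb by blast
  moreover obtain f where "amul \<mu> e2 e4 = f *s e5" using F5(4,6) F5_comb by blast
  moreover obtain h where "amul \<mu> e3 e4 = h *s e5" using F5(4,6) F5_comb by blast
  moreover have "amul \<mu> x e5 = 0" for x using F6(4,6) F6_0 by blast
  ultimately have "\<mu> \<in> orbit (tri a3 a4 a5 b4 b5 c4 c5 d f h)"
    by (intro orbitI_surj[OF linear_comb5] comb5_hom[OF anti])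
  then show thesis by (rule that)
qed

section \<open>Nilpotency through iterated left multiplication\<close>

primrec lower_central :: "'n::finite mult \<Rightarrow> nat \<Rightarrow> (complex ^ 'n) set" where
  "lower_central \<mu> 0 = UNIV"
| "lower_central \<mu> (Suc m) = vec.span {amul \<mu> x y |x y. y \<in> lower_central \<mu> m}"

text \<open>If k is at least 2^(m+1), one of the exponents i and k - i is at least 2^m.
  Anticommutativity puts that factor on the right, which gives one more left multiplication.\<close>

lemma alg_power_subset_lower_central:
  assumes anti: "anticommutative \<mu>" and "k \<ge> 2 ^ m"
  shows "alg_power \<mu> k \<subseteq> lower_central \<mu> m"
  using assms(2)
proof (induction m arbitrary: k)
  case (Suc m)
  have "(2::nat) ^ m \<ge> 1" by simp
  then have k: "k > 1" using Suc.prems unfolding power_Suc by linarith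
  have "amul \<mu> x y \<in> lower_central \<mu> (Suc m)"
    if xy: "x \<in> alg_power \<mu> i" "y \<in> alg_power \<mu> (k - i)" "i < k" for x y i
  proof (cases "k - i \<ge> 2 ^ m")
    case True
    then show ?thesis using Suc.IH xy by (auto intro!: vec.span_base)
  next
    case False
    then have "i \<ge> 2 ^ m" using Suc.prems xy(3) by simp
    then have "amul \<mu> y x \<in> lower_central \<mu> (Suc m)"
      using Suc.IH xy by (auto intro!: vec.span_base)
    then have "- amul \<mu> y x \<in> lower_central \<mu> (Suc m)" by (simp add: vec.span_neg)
    then show ?thesis using anti unfolding anticommutative_def by metis
  qed
  then have "(\<Union>i\<in>{0<..<k}. {amul \<mu> x y |x y. x \<in> alg_power \<mu> i \<and> y \<in> alg_power \<mu> (k - i)})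
      \<subseteq> lower_central \<mu> (Suc m)"
    by (auto simp del: lower_central.simps)
  from vec.span_minimal[OF this] show ?case
    using k unfolding alg_power.simps[of \<mu> k] by (simp add: vec.subspace_span)
qed simp

text \<open>A flag of length five bounds the nilpotency class uniformly, so nilpotency is a closed
  condition.\<close>

lemma nilpotent_iff_fourfold_zero:
  fixes \<mu> :: "5 mult"
  assumes anti: "anticommutative \<mu>"
  shows "nilpotent \<mu> \<longleftrightarrow> (\<forall>x y z u v. amul \<mu> x (amul \<mu> y (amul \<mu> z (amul \<mu> u v))) = 0)"
proof
  assume "nilpotent \<mu>"
  then obtain a3 a4 a5 b4 b5 c4 c5 d f h where "\<mu> \<in> orbit (tri a3 a4 a5 b4 b5 c4 c5 d f h)"
    using anti by (rule nilpotent_orbit_tri)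
  then obtain g g' where g: "Vector_Spaces.linear (*s) (*s) g" "\<And>x. g' (g x) = x"
      "\<And>x y. amul \<mu> x y = g (amul (tri a3 a4 a5 b4 b5 c4 c5 d f h) (g' x) (g' y))"
    using orbitE by metis
  have "amul (tri a3 a4 a5 b4 b5 c4 c5 d f h) x (amul (tri a3 a4 a5 b4 b5 c4 c5 d f h) y
      (amul (tri a3 a4 a5 b4 b5 c4 c5 d f h) z (amul (tri a3 a4 a5 b4 b5 c4 c5 d f h) u v))) = 0"
    for x y z u v by (simp add: amul_tri vec_eq_iff forall_5)
  then show "\<forall>x y z u v. amul \<mu> x (amul \<mu> y (amul \<mu> z (amul \<mu> u v))) = 0"
    by (simp add: g(2,3) vec.linear_0[OF g(1)])
next
  assume A: "\<forall>x y z u v. amul \<mu> x (amul \<mu> y (amul \<mu> z (amul \<mu> u v))) = 0"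
  note s = vec.subspace_def amul_add_right amul_scale_right
  have "lower_central \<mu> 1 \<subseteq> {w. \<forall>x y z. amul \<mu> x (amul \<mu> y (amul \<mu> z w)) = 0}"
    unfolding One_nat_def lower_central.simps(2) by (rule vec.span_minimal) (use A in \<open>auto simp: s\<close>)
  then have "lower_central \<mu> (Suc 1) \<subseteq> {w. \<forall>x y. amul \<mu> x (amul \<mu> y w) = 0}"
    unfolding lower_central.simps(2)[of \<mu> 1] by (intro vec.span_minimal) (auto simp: s)
  then have "lower_central \<mu> (Suc (Suc 1)) \<subseteq> {w. \<forall>x. amul \<mu> x w = 0}"
    unfolding lower_central.simps(2)[of \<mu> "Suc 1"] by (intro vec.span_minimal) (auto simp: s)
  then have "lower_central \<mu> (Suc (Suc (Suc 1))) \<subseteq> {0}"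
    unfolding lower_central.simps(2)[of \<mu> "Suc (Suc 1)"] by (intro vec.span_minimal) (auto simp: s)
  \<comment> \<open>The term of index 4 vanishes, and 16 = 2^4.\<close>
  then have "alg_power \<mu> 16 \<subseteq> {0}"
    using alg_power_subset_lower_central[OF anti, of "Suc (Suc (Suc 1))" 16] by simp
  moreover have "0 \<in> alg_power \<mu> 16" by (subst alg_power.simps) (simp add: vec.span_zero)
  ultimately show "nilpotent \<mu>" unfolding nilpotent_def by (intro exI[of _ 16]) auto
qed

section \<open>Zariski closed sets, curves and irreducible orbits\<close>

lemma polynomial_fun_sum:
  "(\<And>a. a \<in> S \<Longrightarrow> polynomial_fun (p a)) \<Longrightarrow> polynomial_fun (\<lambda>\<mu>. \<Sum>a\<in>S. p a \<mu>)"
  by (induction S rule: infinite_finite_induct) (auto intro: polynomial_fun.intros)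

lemma polynomial_fun_minus: "polynomial_fun p \<Longrightarrow> polynomial_fun (\<lambda>\<mu>. - p \<mu>)"
  using polynomial_fun.mult[OF polynomial_fun.const[of "-1"], of p] by simp

definition polynomial_vec :: "('n::finite mult \<Rightarrow> complex ^ 'n) \<Rightarrow> bool" where
  "polynomial_vec X \<longleftrightarrow> (\<forall>k. polynomial_fun (\<lambda>\<mu>. X \<mu> $ k))"

lemma polynomial_vec_const: "polynomial_vec (\<lambda>_. v)"
  by (simp add: polynomial_vec_def polynomial_fun.const)

lemma polynomial_vec_add: "polynomial_vec X \<Longrightarrow> polynomial_vec Y \<Longrightarrow> polynomial_vec (\<lambda>\<mu>. X \<mu> + Y \<mu>)"
  by (simp add: polynomial_vec_def polynomial_fun.add)

lemma polynomial_vec_minus: "polynomial_vec X \<Longrightarrow> polynomial_vec (\<lambda>\<mu>. - X \<mu>)"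
  by (simp add: polynomial_vec_def polynomial_fun_minus)

lemma polynomial_vec_amul:
  "polynomial_vec X \<Longrightarrow> polynomial_vec Y \<Longrightarrow> polynomial_vec (\<lambda>\<mu>. amul \<mu> (X \<mu>) (Y \<mu>))"
  unfolding polynomial_vec_def amul_def
  by (auto intro!: polynomial_fun_sum polynomial_fun.mult polynomial_fun.coord)

lemma polynomial_vec_jacobian:
  "polynomial_vec X \<Longrightarrow> polynomial_vec Y \<Longrightarrow> polynomial_vec Z \<Longrightarrow>
     polynomial_vec (\<lambda>\<mu>. jacobian \<mu> (X \<mu>) (Y \<mu>) (Z \<mu>))"
  unfolding jacobian_def by (intro polynomial_vec_add polynomial_vec_amul)

lemmas polynomial_vec_intros =
  polynomial_vec_const polynomial_vec_minus polynomial_vec_amul polynomial_vec_jacobian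

text \<open>Arbitrary intersections of closed sets are closed, so identities may be quantified over
  all vectors without reduction to a basis.\<close>

lemma zariski_closed_all:
  assumes "\<And>i. zariski_closed {\<mu>. P i \<mu>}"
  shows "zariski_closed {\<mu>. \<forall>i. P i \<mu>}"
proof -
  have "{\<mu>. \<forall>i. P i \<mu>} = (\<Inter>i. {\<mu>. P i \<mu>})" by blast
  then show ?thesis using zariski_closed_Inter[of "range (\<lambda>i. {\<mu>. P i \<mu>})"] assms by auto
qed

lemma zariski_closed_Int: "zariski_closed S \<Longrightarrow> zariski_closed T \<Longrightarrow> zariski_closed (S \<inter> T)"
  using zariski_closed_Inter[of "{S, T}"] by auto

lemma zariski_closed_eq:
  assumes "polynomial_fun p" "polynomial_fun q"
  shows "zariski_closed {\<mu>. p \<mu> = q \<mu>}"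
proof -
  have "polynomial_fun (\<lambda>\<mu>. p \<mu> + - q \<mu>)" using assms by (intro polynomial_fun.add polynomial_fun_minus)
  then show ?thesis unfolding zariski_closed_def
    by (intro exI[of _ "{\<lambda>\<mu>. p \<mu> + - q \<mu>}"]) auto
qed

lemma zariski_closed_vec_eq:
  assumes "polynomial_vec X" "polynomial_vec Y"
  shows "zariski_closed {\<mu>. X \<mu> = Y \<mu>}"
  unfolding vec_eq_iff using assms
  by (intro zariski_closed_all zariski_closed_eq) (auto simp: polynomial_vec_def)

section \<open>Closedness of the varieties\<close>

lemma zariski_closed_anticommutative: "zariski_closed {\<mu>. anticommutative \<mu>}"
  unfolding anticommutative_def by (intro zariski_closed_all zariski_closed_vec_eq polynomial_vec_intros)

lemma zariski_closed_malcev: "zariski_closed {\<mu>. malcev \<mu>}"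
proof -
  have "zariski_closed ({\<mu>. anticommutative \<mu>} \<inter>
      {\<mu> :: 'a mult. \<forall>x y z. jacobian \<mu> x y (amul \<mu> x z) = amul \<mu> (jacobian \<mu> x y z) x})"
    by (intro zariski_closed_Int zariski_closed_anticommutative zariski_closed_all
        zariski_closed_vec_eq polynomial_vec_intros)
  then show ?thesis unfolding malcev_def Collect_conj_eq .
qed

lemma zariski_closed_lie: "zariski_closed {\<mu>. lie \<mu>}"
proof -
  have "zariski_closed ({\<mu>. anticommutative \<mu>} \<inter> {\<mu> :: 'a mult. \<forall>x y z. jacobian \<mu> x y z = 0})"
    by (intro zariski_closed_Int zariski_closed_anticommutative zariski_closed_all
        zariski_closed_vec_eq polynomial_vec_intros)
  then show ?thesis unfolding lie_def Collect_conj_eq .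
qed

lemma zariski_closed_fourfold_zero:
  "zariski_closed {\<mu>. \<forall>x y z u v. amul \<mu> x (amul \<mu> y (amul \<mu> z (amul \<mu> u v))) = 0}"
  by (intro zariski_closed_all zariski_closed_vec_eq polynomial_vec_intros)

lemma NMal_eq:
  "(NMal :: 5 mult set) = {\<mu>. malcev \<mu>} \<inter> {\<mu>. \<forall>x y z u v. amul \<mu> x (amul \<mu> y (amul \<mu> z (amul \<mu> u v))) = 0}"
  unfolding NMal_def using nilpotent_iff_fourfold_zero by (auto simp: malcev_def)

lemma NLie_eq:
  "(NLie :: 5 mult set) = {\<mu>. lie \<mu>} \<inter> {\<mu>. \<forall>x y z u v. amul \<mu> x (amul \<mu> y (amul \<mu> z (amul \<mu> u v))) = 0}"
  unfolding NLie_def using nilpotent_iff_fourfold_zero by (auto simp: lie_def)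

lemma zariski_closed_NMal: "zariski_closed (NMal :: 5 mult set)"
  unfolding NMal_eq by (intro zariski_closed_Int zariski_closed_malcev zariski_closed_fourfold_zero)

lemma zariski_closed_NLie: "zariski_closed (NLie :: 5 mult set)"
  unfolding NLie_eq by (intro zariski_closed_Int zariski_closed_lie zariski_closed_fourfold_zero)

lemma zariski_closure_iff:
  "\<mu> \<in> zariski closure_of S \<longleftrightarrow> (\<forall>p. polynomial_fun p \<and> (\<forall>\<nu>\<in>S. p \<nu> = 0) \<longrightarrow> p \<mu> = 0)"
proof (intro iffI allI impI)
  fix p :: "'a mult \<Rightarrow> complex"
  assume \<mu>: "\<mu> \<in> zariski closure_of S" and p: "polynomial_fun p \<and> (\<forall>\<nu>\<in>S. p \<nu> = 0)"
  have "zariski closure_of S \<subseteq> {\<mu>. p \<mu> = 0}"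
    using p by (intro closure_of_minimal) (auto simp: closedin_zariski intro: zariski_closed_eq polynomial_fun.const)
  then show "p \<mu> = 0" using \<mu> by blast
next
  assume \<mu>: "\<forall>p. polynomial_fun p \<and> (\<forall>\<nu>\<in>S. p \<nu> = 0) \<longrightarrow> p \<mu> = 0"
  have "zariski_closed (zariski closure_of S)" by (simp flip: closedin_zariski)
  then obtain P where P: "\<forall>p\<in>P. polynomial_fun p" "zariski closure_of S = {\<mu>. \<forall>p\<in>P. p \<mu> = 0}"
    unfolding zariski_closed_def by blast
  moreover have "S \<subseteq> zariski closure_of S" by (simp add: closure_of_subset)
  ultimately have "p \<mu> = 0" if "p \<in> P" for p using \<mu> that by (auto simp: subset_iff)
  then show "\<mu> \<in> zariski closure_of S" using P(2) by blast
qed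

lemma polynomial_fun_act:
  "polynomial_fun p \<Longrightarrow> polynomial_fun (\<lambda>\<mu>. p (act g \<mu>))"
proof (induction rule: polynomial_fun.induct)
  case (coord i j k)
  have "polynomial_vec (\<lambda>\<mu>. amul \<mu> (matrix_inv g *v axis i 1) (matrix_inv g *v axis j 1))"
    by (intro polynomial_vec_intros)
  then show ?case unfolding act_def polynomial_vec_def
    by (auto simp: matrix_vector_mult_def intro!: polynomial_fun_sum polynomial_fun.mult polynomial_fun.const)
qed (auto intro: polynomial_fun.intros)

text \<open>For fixed \<open>g\<close> the map \<open>act g\<close> is linear in the structure
  constants and preserves the orbit, so a polynomial vanishing on the orbit can be pulled back along
  it.\<close>

lemma closure_orbit_invariant:
  assumes "\<nu> \<in> zariski closure_of orbit \<mu>" "\<rho> \<in> orbit \<nu>"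
  shows "\<rho> \<in> zariski closure_of orbit \<mu>"
  unfolding zariski_closure_iff
proof (intro allI impI)
  fix p assume p: "polynomial_fun p \<and> (\<forall>\<nu>\<in>orbit \<mu>. p \<nu> = 0)"
  obtain g where g: "invertible g" "\<rho> = act g \<nu>" using assms(2) by (auto simp: orbit_def)
  have "act g \<sigma> \<in> orbit \<mu>" if "\<sigma> \<in> orbit \<mu>" for \<sigma>
    using that g(1) orbit_trans[of \<sigma> \<mu> "act g \<sigma>"] by (auto simp: orbit_def)
  then have "polynomial_fun (\<lambda>\<mu>. p (act g \<mu>)) \<and> (\<forall>\<nu>\<in>orbit \<mu>. p (act g \<nu>) = 0)"
    using p polynomial_fun_act by blast
  then show "p \<rho> = 0" using assms(1) unfolding zariski_closure_iff g(2) by blast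
qed

section \<open>Restriction of polynomials to lines\<close>

text \<open>Polynomials with powers of \<open>D\<close> as denominators, seen as functions; values
  at the zeros of \<open>D\<close> are arbitrary. \<open>D\<close> = 1 gives polynomials, and a
  determinant as \<open>D\<close> admits inverse matrices.\<close>

definition rational_in :: "complex poly \<Rightarrow> (complex \<Rightarrow> complex) \<Rightarrow> bool" where
  "rational_in D \<phi> \<longleftrightarrow> (\<exists>q n. \<forall>t. poly D t \<noteq> 0 \<longrightarrow> \<phi> t = poly q t / poly D t ^ n)"

lemma rational_in_poly: "rational_in D (poly q)"
  unfolding rational_in_def by (intro exI[of _ q] exI[of _ 0]) simp

lemma rational_in_const: "rational_in D (\<lambda>_. c)"
  unfolding rational_in_def by (intro exI[of _ "[:c:]"] exI[of _ 0]) simp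

lemma rational_in_divide: "rational_in D (\<lambda>t. poly q t / poly D t)"
  unfolding rational_in_def by (intro exI[of _ q] exI[of _ 1]) simp

lemma rational_in_add:
  assumes "rational_in D \<phi>" "rational_in D \<psi>"
  shows "rational_in D (\<lambda>t. \<phi> t + \<psi> t)"
proof -
  obtain q n r m where "\<forall>t. poly D t \<noteq> 0 \<longrightarrow> \<phi> t = poly q t / poly D t ^ n"
    "\<forall>t. poly D t \<noteq> 0 \<longrightarrow> \<psi> t = poly r t / poly D t ^ m" using assms unfolding rational_in_def by blast
  then show ?thesis unfolding rational_in_def
    by (intro exI[of _ "q * D ^ m + r * D ^ n"] exI[of _ "n + m"]) (auto simp: add_divide_distrib power_add)
qed

lemma rational_in_mult:
  assumes "rational_in D \<phi>" "rational_in D \<psi>"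
  shows "rational_in D (\<lambda>t. \<phi> t * \<psi> t)"
proof -
  obtain q n r m where "\<forall>t. poly D t \<noteq> 0 \<longrightarrow> \<phi> t = poly q t / poly D t ^ n"
    "\<forall>t. poly D t \<noteq> 0 \<longrightarrow> \<psi> t = poly r t / poly D t ^ m" using assms unfolding rational_in_def by blast
  then show ?thesis unfolding rational_in_def
    by (intro exI[of _ "q * r"] exI[of _ "n + m"]) (auto simp: power_add)
qed

lemma rational_in_sum: "(\<And>a. a \<in> S \<Longrightarrow> rational_in D (\<phi> a)) \<Longrightarrow> rational_in D (\<lambda>t. \<Sum>a\<in>S. \<phi> a t)"
  by (induction S rule: infinite_finite_induct) (auto intro: rational_in_const rational_in_add)

lemma rational_in_cong: "(\<And>t. poly D t \<noteq> 0 \<Longrightarrow> \<phi> t = \<psi> t) \<Longrightarrow> rational_in D \<psi> \<Longrightarrow> rational_in D \<phi>"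
  unfolding rational_in_def by force

lemma rational_in_polynomial_fun:
  "polynomial_fun p \<Longrightarrow> (\<And>i j k. rational_in D (\<lambda>t. \<gamma> t $ i $ j $ k)) \<Longrightarrow> rational_in D (\<lambda>t. p (\<gamma> t))"
  by (induction rule: polynomial_fun.induct) (auto intro: rational_in_const rational_in_add rational_in_mult)

lemma poly_eq_0_if_cofinite:
  fixes q :: "complex poly"
  assumes "finite {t. poly q t \<noteq> 0}"
  shows "q = 0"
proof (rule ccontr)
  assume "q \<noteq> 0"
  then have "finite ({t. poly q t = 0} \<union> {t. poly q t \<noteq> 0})" using assms poly_roots_finite by blast
  moreover have "{t. poly q t = 0} \<union> {t. poly q t \<noteq> 0} = (UNIV :: complex set)" by blast
  ultimately show False using infinite_UNIV_char_0 by metis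
qed

lemma line_in_closure:
  assumes line: "\<And>t i j k. \<gamma> t $ i $ j $ k = \<mu> $ i $ j $ k + t * \<nu> $ i $ j $ k"
    and fin: "finite {t. \<gamma> t \<notin> S}"
  shows "\<mu> \<in> zariski closure_of S"
  unfolding zariski_closure_iff
proof (intro allI impI)
  fix p assume p: "polynomial_fun p \<and> (\<forall>\<nu>\<in>S. p \<nu> = 0)"
  have "rational_in 1 (\<lambda>t. \<gamma> t $ i $ j $ k)" for i j k
    unfolding line rational_in_def by (intro exI[of _ "[:\<mu> $ i $ j $ k, \<nu> $ i $ j $ k:]"]) simp
  then obtain q where q: "\<And>t. p (\<gamma> t) = poly q t"
    using rational_in_polynomial_fun[of p 1 \<gamma>] p unfolding rational_in_def by auto
  have "{t. poly q t \<noteq> 0} \<subseteq> {t. \<gamma> t \<notin> S}" using p by (auto simp flip: q)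
  then have "q = 0" using fin finite_subset poly_eq_0_if_cofinite by blast
  moreover have "\<gamma> 0 = \<mu>" by (simp add: vec_eq_iff line)
  ultimately show "p \<mu> = 0" using q[of 0] by simp
qed

lemma det_poly:
  fixes A :: "complex \<Rightarrow> complex ^ 'n ^ 'n"
  assumes "\<And>i j. \<exists>q. \<forall>t. A t $ i $ j = poly q t"
  shows "\<exists>D. \<forall>t. det (A t) = poly D t"
proof -
  obtain Q where Q: "\<And>i j t. A t $ i $ j = poly (Q i j) t" using assms by metis
  show ?thesis unfolding det_def Q
    by (intro exI[of _ "\<Sum>p\<in>{p. p permutes UNIV}. of_int (sign p) * (\<Prod>i\<in>UNIV. Q i (p i))"])
      (simp add: poly_sum poly_prod)
qed

text \<open>Matrices moving \<open>\<mu>\<close> outside \<open>A\<close> and outside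
  \<open>B\<close> are joined by a line. Polynomials witnessing the two facts would have product
  zero at every invertible matrix on it.\<close>

lemma irreducible_orbit:
  assumes A: "zariski_closed A" and B: "zariski_closed B" and AB: "orbit \<mu> \<subseteq> A \<union> B"
  shows "orbit \<mu> \<subseteq> A \<or> orbit \<mu> \<subseteq> B"
proof (rule ccontr)
  assume "\<not> (orbit \<mu> \<subseteq> A \<or> orbit \<mu> \<subseteq> B)"
  then obtain g1 g2 where g: "invertible g1" "invertible g2" "act g1 \<mu> \<notin> A" "act g2 \<mu> \<notin> B"
    by (auto simp: orbit_def)
  obtain p where p: "polynomial_fun p" "\<And>\<nu>. \<nu> \<in> A \<Longrightarrow> p \<nu> = 0" "p (act g1 \<mu>) \<noteq> 0"
    using A g(3) unfolding zariski_closed_def by auto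
  obtain q where q: "polynomial_fun q" "\<And>\<nu>. \<nu> \<in> B \<Longrightarrow> q \<nu> = 0" "q (act g2 \<mu>) \<noteq> 0"
    using B g(4) unfolding zariski_closed_def by auto
  define G where "G t = (\<chi> a b. (1 - t) * g1 $ a $ b + t * g2 $ a $ b)" for t
  have G01: "G 0 = g1" "G 1 = g2" by (simp_all add: G_def vec_eq_iff)
  have Gpoly: "\<exists>q. \<forall>t. G t $ a $ b = poly q t" for a b
    by (intro exI[of _ "[:g1 $ a $ b, g2 $ a $ b - g1 $ a $ b:]"]) (simp add: G_def algebra_simps)
  obtain D where D: "\<And>t. det (G t) = poly D t" using det_poly[of G] Gpoly by blast
  have inv: "invertible (G t) \<longleftrightarrow> poly D t \<noteq> 0" for t by (simp add: invertible_det_nz D)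
  have rinv: "rational_in D (\<lambda>t. (matrix_inv (G t) *v axis i 1) $ k)" for i k
  proof -
    \<comment> \<open>Cramer's rule: column \<open>k\<close> of \<open>G t\<close> is replaced by
      the \<open>i\<close>-th unit vector, so an entry of the inverse is a quotient with denominator
      \<open>D\<close>.\<close>
    let ?M = "\<lambda>t. (\<chi> a b. if b = k then axis i 1 $ a else G t $ a $ b) :: complex ^ 'a ^ 'a"
    have "\<exists>q. \<forall>t. ?M t $ a $ b = poly q t" for a b
    proof (cases "b = k")
      case True
      then show ?thesis by (intro exI[of _ "[:axis i 1 $ a:]"]) simp
    next
      case False
      then show ?thesis using Gpoly[of a b] by simp
    qed
    then obtain q where q: "\<And>t. det (?M t) = poly q t" using det_poly[of ?M] by blast
    have "(matrix_inv (G t) *v axis i 1) $ k = poly q t / poly D t" if "poly D t \<noteq> 0" for t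
    proof -
      have "G t *v (matrix_inv (G t) *v axis i 1) = axis i 1"
        using that by (intro matrix_inv_cancel) (simp add: inv)
      then have "matrix_inv (G t) *v axis i 1
          = (\<chi> k. det (\<chi> a b. if b = k then axis i 1 $ a else G t $ a $ b) / det (G t))"
        using that by (subst (asm) cramer) (simp_all add: D)
      then show ?thesis by (simp add: q D)
    qed
    then show ?thesis using rational_in_divide[of D q] by (rule rational_in_cong)
  qed
  have rG: "rational_in D (\<lambda>t. G t $ a $ b)" for a b
    using Gpoly[of a b] rational_in_poly[of D] by (metis (no_types, lifting) ext)
  have "rational_in D (\<lambda>t. act (G t) \<mu> $ i $ j $ k)" for i j k
    unfolding act_def amul_def
    by (auto simp: matrix_vector_mult_def[of "G _"] intro!: rational_in_sum rational_in_mult rG rinv rational_in_const)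
  then have "rational_in D (\<lambda>t. p (act (G t) \<mu>))" "rational_in D (\<lambda>t. q (act (G t) \<mu>))"
    using rational_in_polynomial_fun[OF p(1), of D "\<lambda>t. act (G t) \<mu>"]
      rational_in_polynomial_fun[OF q(1), of D "\<lambda>t. act (G t) \<mu>"] by simp_all
  then obtain P n Q m
    where P: "\<And>t. poly D t \<noteq> 0 \<Longrightarrow> p (act (G t) \<mu>) = poly P t / poly D t ^ n"
      and Q: "\<And>t. poly D t \<noteq> 0 \<Longrightarrow> q (act (G t) \<mu>) = poly Q t / poly D t ^ m"
    unfolding rational_in_def by blast
  \<comment> \<open>The factor \<open>D\<close> covers the parameters where \<open>G t\<close> is
    singular. The product is then the zero polynomial, although \<open>D\<close> and
    \<open>P\<close> are nonzero at 0 and \<open>Q\<close> at 1.\<close>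
  have "poly (D * P * Q) t = 0" for t
  proof (cases "poly D t = 0")
    case False
    then have "act (G t) \<mu> \<in> A \<union> B" using AB inv by (auto simp: orbit_def)
    then have "p (act (G t) \<mu>) = 0 \<or> q (act (G t) \<mu>) = 0" using p(2) q(2) by blast
    then show ?thesis using P[OF False] Q[OF False] False by auto
  qed simp
  then have "D * P * Q = 0" using poly_all_0_iff_0 by blast
  moreover have "poly D 0 \<noteq> 0" "poly D 1 \<noteq> 0" using g(1,2) by (simp_all add: G01 flip: inv)
  moreover from this have "P \<noteq> 0" "Q \<noteq> 0" using P[of 0] Q[of 1] p(3) q(3) by (auto simp: G01)
  ultimately show False by auto
qed

section \<open>Closures of the orbits\<close>

lemma tri_line:
  "tri (a3 + t * a3') (a4 + t * a4') (a5 + t * a5') (b4 + t * b4') (b5 + t * b5') (c4 + t * c4')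
       (c5 + t * c5') (d + t * d') (f + t * f') (h + t * h') $ i $ j $ k
     = tri a3 a4 a5 b4 b5 c4 c5 d f h $ i $ j $ k
       + t * tri a3' a4' a5' b4' b5' c4' c5' d' f' h' $ i $ j $ k"
proof -
  have "\<forall>i j k. tri (a3 + t * a3') (a4 + t * a4') (a5 + t * a5') (b4 + t * b4') (b5 + t * b5')
        (c4 + t * c4') (c5 + t * c5') (d + t * d') (f + t * f') (h + t * h') $ i $ j $ k
      = tri a3 a4 a5 b4 b5 c4 c5 d f h $ i $ j $ k
        + t * tri a3' a4' a5' b4' b5' c4' c5' d' f' h' $ i $ j $ k"
    by (simp add: forall_5 tri_def)
  then show ?thesis by blast
qed

text \<open>Moving in the direction \<open>M5\<close> adds t to \<open>a4\<close> and
  \<open>h\<close>. The Lie condition becomes a quadratic equation in t with leading coefficient -1,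
  so all but at most two points of the line are non-Lie, hence in the orbit.\<close>

lemma flat_in_closure_M5: "flat \<subseteq> zariski closure_of orbit M5"
proof -
  have *: "tri 0 a4 a5 b4 b5 c4 c5 d f h \<in> zariski closure_of orbit M5" for a4 a5 b4 b5 c4 c5 d f h
  proof (rule line_in_closure)
    show "tri 0 (a4 + t) a5 b4 b5 c4 c5 d f (h + t) $ i $ j $ k
        = tri 0 a4 a5 b4 b5 c4 c5 d f h $ i $ j $ k + t * M5 $ i $ j $ k" for t i j k
      using tri_line[of 0 t 0 a4 1 a5 0 b4 0 b5 0 c4 0 c5 0 d 0 f 0 h 1 i j k] by (simp add: M5_eq_tri)
    let ?q = "[:b4 * f - c4 * d - a4 * h, - a4 - h, - 1:]"
    have q: "b4 * f - c4 * d - (a4 + t) * (h + t) = poly ?q t" for t by (simp add: algebra_simps)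
    have "poly ?q t = 0" if "tri 0 (a4 + t) a5 b4 b5 c4 c5 d f (h + t) \<notin> orbit M5" for t
    proof -
      have "lie (tri 0 (a4 + t) a5 b4 b5 c4 c5 d f (h + t))" using that not_lie_in_orbit_M5 by blast
      then show ?thesis unfolding lie_tri_iff q .
    qed
    then have "{t. tri 0 (a4 + t) a5 b4 b5 c4 c5 d f (h + t) \<notin> orbit M5} \<subseteq> {t. poly ?q t = 0}"
      by blast
    then show "finite {t. tri 0 (a4 + t) a5 b4 b5 c4 c5 d f (h + t) \<notin> orbit M5}"
      by (rule finite_subset) (rule poly_roots_finite, simp)
  qed
  show ?thesis
  proof
    fix \<mu> assume "\<mu> \<in> flat"
    then show "\<mu> \<in> zariski closure_of orbit M5"
      by (rule flatE) (rule closure_orbit_invariant[OF *])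
  qed
qed

text \<open>In the direction \<open>g56\<close> the premises of \<open>tri_in_orbit_g56\<close> fail
  for at most four parameters.\<close>

lemma tri_in_closure_g56: "tri a3 a4 a5 b4 b5 0 c5 d 0 0 \<in> zariski closure_of orbit g56"
proof (rule line_in_closure)
  show "tri (a3 + t) a4 a5 (b4 + t) b5 0 (c5 + t) (d + t) 0 0 $ i $ j $ k
      = tri a3 a4 a5 b4 b5 0 c5 d 0 0 $ i $ j $ k + t * g56 $ i $ j $ k" for t i j k
    using tri_line[of a3 t 1 a4 0 a5 0 b4 1 b5 0 0 0 c5 1 d 1 0 0 0 0 i j k] by (simp add: g56_eq_tri)
  have "{t. tri (a3 + t) a4 a5 (b4 + t) b5 0 (c5 + t) (d + t) 0 0 \<notin> orbit g56} \<subseteq> {- a3, - b4, - c5, - d}"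
  proof (intro subsetI, rule ccontr)
    fix t assume t: "t \<in> {t. tri (a3 + t) a4 a5 (b4 + t) b5 0 (c5 + t) (d + t) 0 0 \<notin> orbit g56}"
      "t \<notin> {- a3, - b4, - c5, - d}"
    then have "a3 + t \<noteq> 0" "b4 + t \<noteq> 0" "c5 + t \<noteq> 0" "d + t \<noteq> 0" by (auto simp: add_eq_0_iff)
    then show False using t(1) tri_in_orbit_g56 by blast
  qed
  then show "finite {t. tri (a3 + t) a4 a5 (b4 + t) b5 0 (c5 + t) (d + t) 0 0 \<notin> orbit g56}"
    by (rule finite_subset) simp
qed

lemma nilpotent_tri: "nilpotent (tri a3 a4 a5 b4 b5 c4 c5 d f h)"
  unfolding nilpotent_iff_fourfold_zero[OF anticommutative_tri]
  by (simp add: amul_tri vec_eq_iff forall_5)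

lemma nilpotent_orbit:
  fixes \<mu> :: "5 mult"
  assumes "\<nu> \<in> orbit \<mu>" "anticommutative \<mu>" "nilpotent \<mu>"
  shows "nilpotent \<nu>"
proof -
  obtain f f' where f: "Vector_Spaces.linear (*s) (*s) f" "\<And>x. f' (f x) = x"
    "\<And>x y. amul \<nu> x y = f (amul \<mu> (f' x) (f' y))" using assms(1) orbitE by metis
  have "anticommutative \<nu>" using assms anticommutative_orbit by blast
  then show ?thesis using assms(2,3)
    by (simp add: nilpotent_iff_fourfold_zero f(2,3) vec.linear_0[OF f(1)])
qed

lemma orbit_subset_NMal: "(\<mu> :: 5 mult) \<in> NMal \<Longrightarrow> orbit \<mu> \<subseteq> NMal"
  using nilpotent_orbit malcev_orbit unfolding NMal_def malcev_def by blast

lemma orbit_subset_NLie: "(\<mu> :: 5 mult) \<in> NLie \<Longrightarrow> orbit \<mu> \<subseteq> NLie"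
  using nilpotent_orbit lie_orbit unfolding NLie_def lie_def by blast

lemma NLie_subset_NMal: "NLie \<subseteq> NMal"
  unfolding NLie_def NMal_def lie_def malcev_def by auto

lemma g56_in_NLie: "g56 \<in> NLie"
  unfolding NLie_def lie_def g56_eq_tri
  by (simp add: nilpotent_tri anticommutative_tri jacobian_tri vec_eq_iff forall_5)

lemma M5_in_NMal: "M5 \<in> NMal"
  unfolding NMal_def malcev_def M5_eq_tri
  by (simp add: nilpotent_tri anticommutative_tri jacobian_tri amul_tri vec_eq_iff forall_5)

lemma not_lie_M5: "\<not> lie M5"
  unfolding M5_eq_tri lie_tri_iff by simp

lemma closure_g56_subset_NLie: "zariski closure_of orbit g56 \<subseteq> NLie"
  by (intro closure_of_minimal orbit_subset_NLie g56_in_NLie) (simp add: closedin_zariski zariski_closed_NLie)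

lemma two_generated_in_closure_g56:
  "orbit g54 \<union> orbit g55 \<union> orbit g56 \<subseteq> zariski closure_of orbit g56"
proof -
  have "{g54, g55, g56} \<subseteq> zariski closure_of orbit g56"
    by (auto simp: g54_eq_tri g55_eq_tri g56_eq_tri tri_in_closure_g56[unfolded g56_eq_tri])
  then show ?thesis using closure_orbit_invariant by blast
qed

lemma NMal_cases: "(NMal :: 5 mult set) \<subseteq> orbit g54 \<union> orbit g55 \<union> orbit g56 \<union> flat"
proof
  fix \<mu> :: "5 mult" assume \<mu>: "\<mu> \<in> NMal"
  then have "nilpotent \<mu>" "anticommutative \<mu>" by (simp_all add: NMal_def malcev_def)
  then obtain a3 a4 a5 b4 b5 c4 c5 d f h where o: "\<mu> \<in> orbit (tri a3 a4 a5 b4 b5 c4 c5 d f h)"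
    by (rule nilpotent_orbit_tri)
  have "malcev (tri a3 a4 a5 b4 b5 c4 c5 d f h)"
    using malcev_orbit[OF orbit_sym[OF o]] \<mu> unfolding NMal_def by blast
  then show "\<mu> \<in> orbit g54 \<union> orbit g55 \<union> orbit g56 \<union> flat"
    using malcev_tri_cases orbit_trans[OF _ o] flat_orbit[OF o] by blast
qed

lemma closure_g56_eq_NLie: "zariski closure_of orbit g56 = NLie"
proof (intro subset_antisym closure_g56_subset_NLie subsetI)
  fix \<mu> :: "5 mult" assume \<mu>: "\<mu> \<in> NLie"
  then have "\<mu> \<in> orbit g54 \<union> orbit g55 \<union> orbit g56 \<union> flat" using NLie_subset_NMal NMal_cases by blast
  then consider "\<mu> \<in> orbit g54 \<union> orbit g55 \<union> orbit g56" | "\<mu> \<in> flat" by blast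
  then show "\<mu> \<in> zariski closure_of orbit g56"
  proof cases
    case 1
    then show ?thesis using two_generated_in_closure_g56 by blast
  next
    case 2
    then obtain a4 a5 b4 b5 c4 c5 d f h where o: "\<mu> \<in> orbit (tri 0 a4 a5 b4 b5 c4 c5 d f h)"
      by (rule flatE)
    have "lie (tri 0 a4 a5 b4 b5 c4 c5 d f h)"
      using lie_orbit[OF orbit_sym[OF o]] \<mu> unfolding NLie_def by blast
    then obtain a4' a5' b4' b5' c5' d' where
      "tri 0 a4 a5 b4 b5 c4 c5 d f h \<in> orbit (tri 0 a4' a5' b4' b5' 0 c5' d' 0 0)"
      using lie_tri_normal_form by meson
    from orbit_trans[OF this o] show ?thesis by (rule closure_orbit_invariant[OF tri_in_closure_g56])
  qed
qed

text \<open>The three classes besides \<open>flat\<close> are Lie, being in the closure of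
  \<open>orbit g56\<close>, so non-Lie members are flat. As \<open>NLie\<close> is closed, this
  makes \<open>orbit M5\<close> open in \<open>NMal\<close>.\<close>

lemma orbit_M5_eq: "orbit M5 = NMal - NLie"
proof (intro subset_antisym subsetI)
  fix \<mu> assume \<mu>: "\<mu> \<in> orbit M5"
  then show "\<mu> \<in> NMal - NLie"
    using orbit_subset_NMal[OF M5_in_NMal] lie_orbit[OF orbit_sym[OF \<mu>]] not_lie_M5
    unfolding NLie_def by blast
next
  fix \<mu> :: "5 mult" assume \<mu>: "\<mu> \<in> NMal - NLie"
  then have "\<mu> \<in> flat" using NMal_cases two_generated_in_closure_g56 closure_g56_subset_NLie by blast
  then obtain a4 a5 b4 b5 c4 c5 d f h where o: "\<mu> \<in> orbit (tri 0 a4 a5 b4 b5 c4 c5 d f h)"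
    by (rule flatE)
  have "\<not> lie \<mu>" using \<mu> unfolding NLie_def NMal_def by blast
  then show "\<mu> \<in> orbit M5" using lie_orbit[OF o] orbit_trans[OF not_lie_in_orbit_M5 o] by blast
qed

section \<open>Closed conditions separating the orbits\<close>

text \<open>An injective linear map keeps e4 and e5 independent, whereas the last premise makes all
  2x2 minors of their images vanish.\<close>

lemma basis_images_not_parallel:
  assumes f: "Vector_Spaces.linear (*s) (*s) f" and inv: "\<And>x. f' (f x) = x"
    and par: "\<And>k l. f (vec5 0 0 0 1 0) $ k * f (vec5 0 0 0 0 1) $ l = f (vec5 0 0 0 0 1) $ k * f (vec5 0 0 0 1 0) $ l"
  shows False
proof -
  let ?u = "f (vec5 0 0 0 1 0)" and ?v = "f (vec5 0 0 0 0 1)"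
  have "vec5 0 0 0 1 0 \<noteq> 0" by (simp add: vec_eq_iff forall_5)
  then have "?u \<noteq> 0" using inv vec.linear_0[OF f] by metis
  then obtain k where k: "?u $ k \<noteq> 0" by (auto simp: vec_eq_iff)
  have "?v = (?v $ k / ?u $ k) *s ?u"
    using par[of k] k by (simp add: vec_eq_iff field_simps)
  also have "\<dots> = f ((?v $ k / ?u $ k) *s vec5 0 0 0 1 0)" by (simp add: vec.linear_scale[OF f])
  finally have "vec5 0 0 0 0 1 = (?v $ k / ?u $ k) *s vec5 0 0 0 1 0" using inv by metis
  then show False by (simp add: vec_eq_iff forall_5)
qed

text \<open>The products \<open>x(yz)\<close> span at most a line.\<close>

definition cube_rank_le_1 :: "5 mult set" where
  "cube_rank_le_1 = {\<mu>. \<forall>x y z x' y' z' k l.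
     amul \<mu> x (amul \<mu> y z) $ k * amul \<mu> x' (amul \<mu> y' z') $ l
       = amul \<mu> x' (amul \<mu> y' z') $ k * amul \<mu> x (amul \<mu> y z) $ l}"

text \<open>This closed set contains the orbit of \<open>g54\<close>, and
  \<open>left_rank_le_1\<close> that of \<open>g55\<close>; neither meets the orbit of
  \<open>g56\<close>.\<close>

definition fourth_power_zero :: "5 mult set" where
  "fourth_power_zero = {\<mu>. \<forall>x y z u. amul \<mu> x (amul \<mu> y (amul \<mu> z u)) = 0}"

text \<open>\<open>x(yz) = \<xi>(x) \<phi>(y, z)\<close> for a linear form \<open>\<xi>\<close> and a vector \<open>\<phi>(y, z)\<close>.\<close>

definition left_rank_le_1 :: "5 mult set" where
  "left_rank_le_1 = {\<mu>. \<forall>x y z x' y' z' k l.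
     amul \<mu> x (amul \<mu> y z) $ k * amul \<mu> x' (amul \<mu> y' z') $ l
       = amul \<mu> x' (amul \<mu> y z) $ k * amul \<mu> x (amul \<mu> y' z') $ l}"

lemma polynomial_fun_cube: "polynomial_fun (\<lambda>\<mu>. amul \<mu> x (amul \<mu> y z) $ k)"
proof -
  have "polynomial_vec (\<lambda>\<mu>. amul \<mu> x (amul \<mu> y z))" by (intro polynomial_vec_intros)
  then show ?thesis unfolding polynomial_vec_def by blast
qed

lemma zariski_closed_cube_rank_le_1: "zariski_closed cube_rank_le_1"
  unfolding cube_rank_le_1_def
  by (intro zariski_closed_all zariski_closed_eq polynomial_fun.mult polynomial_fun_cube)

lemma zariski_closed_left_rank_le_1: "zariski_closed left_rank_le_1"
  unfolding left_rank_le_1_def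
  by (intro zariski_closed_all zariski_closed_eq polynomial_fun.mult polynomial_fun_cube)

lemma zariski_closed_fourth_power_zero: "zariski_closed fourth_power_zero"
  unfolding fourth_power_zero_def by (intro zariski_closed_all zariski_closed_vec_eq polynomial_vec_intros)

lemma orbit_M5_cube_rank: "orbit M5 \<subseteq> cube_rank_le_1"
proof
  fix \<mu> assume "\<mu> \<in> orbit M5"
  then obtain f f' where f: "Vector_Spaces.linear (*s) (*s) f" "\<And>x. f' (f x) = x"
    "\<And>x y. amul \<mu> x y = f (amul M5 (f' x) (f' y))" using orbitE by metis
  have "amul M5 x (amul M5 y z) = amul M5 x (amul M5 y z) $ 5 *s vec5 0 0 0 0 1" for x y z
    by (simp add: M5_eq_tri amul_tri vec_eq_iff forall_5)
  then have "amul \<mu> x (amul \<mu> y z) = amul M5 (f' x) (amul M5 (f' y) (f' z)) $ 5 *s f (vec5 0 0 0 0 1)"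
    for x y z unfolding f(2,3) by (metis vec.linear_scale[OF f(1)])
  then show "\<mu> \<in> cube_rank_le_1" unfolding cube_rank_le_1_def by simp
qed

text \<open>In these tables e1(e1e2) = e4, while e2(e1e2) = c e5 and e1(e1e3) = d e5. Since
  \<open>c\<close> or \<open>d\<close> is 1, both e4 and e5 are of the form x(yz).\<close>

lemma two_generated_not_cube_rank: "(orbit g54 \<union> orbit g55 \<union> orbit g56) \<inter> cube_rank_le_1 = {}"
proof -
  have False if o: "\<mu> \<in> orbit (tri 1 0 0 1 0 0 c d 0 0)" and cd: "c = 1 \<or> d = 1"
    and \<mu>: "\<mu> \<in> cube_rank_le_1" for \<mu> c d
  proof -
    obtain f f' where f: "Vector_Spaces.linear (*s) (*s) f" "\<And>x. f (f' x) = x" "\<And>x. f' (f x) = x"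
      "\<And>x y. amul \<mu> x y = f (amul (tri 1 0 0 1 0 0 c d 0 0) (f' x) (f' y))"
      by (rule orbitE[OF o]) (rule that)
    let ?e1 = "f (vec5 1 0 0 0 0)" and ?e2 = "f (vec5 0 1 0 0 0)" and ?e3 = "f (vec5 0 0 1 0 0)"
    have e4: "amul \<mu> ?e1 (amul \<mu> ?e1 ?e2) = f (vec5 0 0 0 1 0)"
      by (simp add: f(3,4) amul_tri)
    have "amul \<mu> ?e2 (amul \<mu> ?e1 ?e2) = f (vec5 0 0 0 0 c)" "amul \<mu> ?e1 (amul \<mu> ?e1 ?e3) = f (vec5 0 0 0 0 d)"
      by (simp_all add: f(3,4) amul_tri)
    then obtain x y z where e5: "amul \<mu> x (amul \<mu> y z) = f (vec5 0 0 0 0 1)" using cd by blast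
    have "f (vec5 0 0 0 1 0) $ k * f (vec5 0 0 0 0 1) $ l = f (vec5 0 0 0 0 1) $ k * f (vec5 0 0 0 1 0) $ l"
      for k l
      using \<mu> unfolding cube_rank_le_1_def e4[symmetric] e5[symmetric] mem_Collect_eq by (elim allE)
    then show False by (rule basis_images_not_parallel[OF f(1,3)])
  qed
  then show ?thesis unfolding g54_eq_tri g55_eq_tri g56_eq_tri by blast
qed

lemma closure_M5_eq: "zariski closure_of orbit M5 = NMal - (orbit g56 \<union> orbit g55 \<union> orbit g54)"
proof
  have "zariski closure_of orbit M5 \<subseteq> NMal \<inter> cube_rank_le_1"
    using orbit_subset_NMal[OF M5_in_NMal] orbit_M5_cube_rank
    by (intro closure_of_minimal)
      (auto simp: closedin_zariski intro!: zariski_closed_Int zariski_closed_NMal zariski_closed_cube_rank_le_1)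
  then show "zariski closure_of orbit M5 \<subseteq> NMal - (orbit g56 \<union> orbit g55 \<union> orbit g54)"
    using two_generated_not_cube_rank by blast
  show "NMal - (orbit g56 \<union> orbit g55 \<union> orbit g54) \<subseteq> zariski closure_of orbit M5"
    using NMal_cases flat_in_closure_M5 by blast
qed

lemma orbit_g54_fourth_power_zero: "orbit g54 \<subseteq> fourth_power_zero"
proof
  fix \<mu> assume "\<mu> \<in> orbit g54"
  then obtain f f' where f: "Vector_Spaces.linear (*s) (*s) f" "\<And>x. f' (f x) = x"
    "\<And>x y. amul \<mu> x y = f (amul g54 (f' x) (f' y))" using orbitE by metis
  have "amul g54 x (amul g54 y (amul g54 z u)) = 0" for x y z u
    by (simp add: g54_eq_tri amul_tri vec_eq_iff forall_5)
  then show "\<mu> \<in> fourth_power_zero" unfolding fourth_power_zero_def by (simp add: f(2,3) vec.linear_0[OF f(1)])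
qed

text \<open>On the square of \<open>g55\<close>, left multiplication by x depends only on the first
  coordinate of x.\<close>

lemma orbit_g55_left_rank: "orbit g55 \<subseteq> left_rank_le_1"
proof
  fix \<mu> assume "\<mu> \<in> orbit g55"
  then obtain f f' where f: "Vector_Spaces.linear (*s) (*s) f" "\<And>x. f' (f x) = x"
    "\<And>x y. amul \<mu> x y = f (amul g55 (f' x) (f' y))" using orbitE by metis
  have "amul g55 x (amul g55 y z) = x $ 1 *s amul g55 (vec5 1 0 0 0 0) (amul g55 y z)" for x y z
    by (simp add: g55_eq_tri amul_tri vec_eq_iff forall_5)
  then have "amul \<mu> x (amul \<mu> y z)
      = f' x $ 1 *s f (amul g55 (vec5 1 0 0 0 0) (amul g55 (f' y) (f' z)))" for x y z
    unfolding f(2,3) by (metis vec.linear_scale[OF f(1)])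
  then show "\<mu> \<in> left_rank_le_1" unfolding left_rank_le_1_def by simp
qed

lemma orbit_g56_disjoint: "orbit g56 \<inter> (fourth_power_zero \<union> left_rank_le_1) = {}"
proof -
  have False if o: "\<mu> \<in> orbit g56" and \<mu>: "\<mu> \<in> fourth_power_zero \<union> left_rank_le_1" for \<mu>
  proof -
    obtain f f' where f: "Vector_Spaces.linear (*s) (*s) f" "\<And>x. f' (f x) = x"
      "\<And>x y. amul \<mu> x y = f (amul g56 (f' x) (f' y))" using o orbitE by metis
    let ?e1 = "f (vec5 1 0 0 0 0)" and ?e2 = "f (vec5 0 1 0 0 0)"
    have e4: "amul \<mu> ?e1 (amul \<mu> ?e1 ?e2) = f (vec5 0 0 0 1 0)"
      and e5: "amul \<mu> ?e2 (amul \<mu> ?e1 ?e2) = f (vec5 0 0 0 0 1)"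
      and e5': "amul \<mu> ?e1 (amul \<mu> ?e1 (amul \<mu> ?e1 ?e2)) = f (vec5 0 0 0 0 1)"
      by (simp_all add: f(2,3) g56_eq_tri amul_tri)
    have "vec5 0 0 0 0 1 \<noteq> 0" by (simp add: vec_eq_iff forall_5)
    then have "f (vec5 0 0 0 0 1) \<noteq> 0" using f(2) vec.linear_0[OF f(1)] by metis
    then have "\<mu> \<notin> fourth_power_zero" unfolding fourth_power_zero_def e5'[symmetric] by blast
    then have "\<mu> \<in> left_rank_le_1" using \<mu> by blast
    \<comment> \<open>The left factors are the images of e1 and e2; both inner products are the
      image of e1e2.\<close>
    then have "f (vec5 0 0 0 1 0) $ k * f (vec5 0 0 0 0 1) $ l = f (vec5 0 0 0 0 1) $ k * f (vec5 0 0 0 1 0) $ l"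
      for k l unfolding left_rank_le_1_def e4[symmetric] e5[symmetric] by blast
    then show False by (rule basis_images_not_parallel[OF f(1,2)])
  qed
  then show ?thesis by blast
qed

text \<open>Removing the closure of \<open>orbit M5\<close> leaves the orbits of \<open>g54\<close>,
  \<open>g55\<close>, \<open>g56\<close>, and the other two closed sets remove the first two. So
  \<open>orbit g56\<close> is open in \<open>NMal\<close>.\<close>

lemma orbit_g56_eq: "orbit g56 = NMal - (zariski closure_of orbit M5 \<union> fourth_power_zero \<union> left_rank_le_1)"
  using orbit_g56_disjoint orbit_g54_fourth_power_zero orbit_g55_left_rank
    orbit_subset_NMal[of g56] g56_in_NLie NLie_subset_NMal
  unfolding closure_M5_eq by blast

section \<open>Irreducible components and rigid algebras\<close>

lemma irreducible_components_two:
  assumes "closedin X C" "closedin X D" "irreducible_in X C" "irreducible_in X D"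
    and "topspace X \<subseteq> C \<union> D" "\<not> C \<subseteq> D" "\<not> D \<subseteq> C"
  shows "irreducible_components X = {C, D}"
proof -
  have cov: "T \<subseteq> C \<or> T \<subseteq> D" if "irreducible_in X T" for T
    using that assms(1,2,5) unfolding irreducible_in_def by blast
  show ?thesis
  proof (intro subset_antisym subsetI)
    fix S assume "S \<in> irreducible_components X"
    then show "S \<in> {C, D}" using cov[of S] assms(1-4) unfolding irreducible_components_def by blast
  next
    fix S assume "S \<in> {C, D}"
    then show "S \<in> irreducible_components X"
      using cov assms unfolding irreducible_components_def by blast
  qed
qed

text \<open>Relatively closed subsets of the closed set \<open>X\<close> are Zariski closed. A
  closed cover of the closure covers the orbit, and the member containing the orbit contains its
  closure.\<close>

lemma irreducible_closure_orbit:
  assumes X: "zariski_closed X" and sub: "orbit \<mu> \<subseteq> X"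
  shows "irreducible_in (subtopology zariski X) (zariski closure_of orbit \<mu>)"
  unfolding irreducible_in_def
proof (intro conjI allI impI)
  have "zariski closure_of orbit \<mu> \<subseteq> X"
    using assms by (intro closure_of_minimal) (auto simp: closedin_zariski)
  then show "zariski closure_of orbit \<mu> \<subseteq> topspace (subtopology zariski X)" by simp
  have orb: "orbit \<mu> \<subseteq> zariski closure_of orbit \<mu>" by (simp add: closure_of_subset)
  then show "zariski closure_of orbit \<mu> \<noteq> {}" using orbit_refl by blast
  fix A B
  assume *: "closedin (subtopology zariski X) A \<and> closedin (subtopology zariski X) B
    \<and> zariski closure_of orbit \<mu> \<subseteq> A \<union> B"
  have AB: "closedin zariski A" "closedin zariski B"
    using * X by (auto simp: closedin_closed_subtopology closedin_zariski)
  then have "orbit \<mu> \<subseteq> A \<or> orbit \<mu> \<subseteq> B"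
    using irreducible_orbit orb * by (metis closedin_zariski subset_trans)
  then show "zariski closure_of orbit \<mu> \<subseteq> A \<or> zariski closure_of orbit \<mu> \<subseteq> B"
    using AB closure_of_minimal by blast
qed

text \<open>An open orbit that meets the closure of another orbit meets that orbit itself, and
  orbits that meet coincide.\<close>

lemma orbit_eq_if_rigid:
  assumes "rigid X \<mu>" "\<mu> \<in> zariski closure_of orbit \<nu>" "orbit \<nu> \<subseteq> X"
  shows "orbit \<mu> = orbit \<nu>"
proof -
  obtain T where T: "openin zariski T" "orbit \<mu> = T \<inter> X"
    using assms(1) unfolding rigid_def openin_subtopology by blast
  have "\<mu> \<in> T" using T(2) orbit_refl by blast
  then obtain \<rho> where "\<rho> \<in> orbit \<nu>" "\<rho> \<in> T" using assms(2) T(1) unfolding in_closure_of by blast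
  then have "\<rho> \<in> orbit \<mu>" "\<rho> \<in> orbit \<nu>" using T(2) assms(3) by auto
  then show ?thesis by (metis orbit_eq_iff)
qed

lemma rigid_if_closed_complement:
  assumes "\<mu> \<in> X" "zariski_closed Z" "orbit \<mu> = X - Z"
  shows "rigid X \<mu>"
  using assms unfolding rigid_def openin_subtopology
  by (auto simp: openin_zariski intro!: exI[of _ "- Z"])

theorem corollary7:
  shows "irreducible_components (subtopology zariski NMal)
           = {zariski closure_of orbit g56, zariski closure_of orbit M5}
       \<and> zariski closure_of orbit g56 \<noteq> zariski closure_of orbit M5
       \<and> zariski closure_of orbit g56 = NLie
       \<and> zariski closure_of orbit M5 = NMal - (orbit g56 \<union> orbit g55 \<union> orbit g54)
       \<and> Rig (NMal :: 5 mult set) = {orbit g56, orbit M5}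
       \<and> orbit g56 \<noteq> orbit M5"
proof -
  let ?C1 = "zariski closure_of orbit g56" and ?C2 = "zariski closure_of orbit M5"
  have g56: "g56 \<in> NMal" using g56_in_NLie NLie_subset_NMal by blast
  have cover: "NMal \<subseteq> ?C1 \<union> ?C2"
    using NMal_cases two_generated_in_closure_g56 flat_in_closure_M5 by blast
  \<comment> \<open>With \<open>C2\<close> this shows that neither closure contains the
    other.\<close>
  have C1: "g56 \<in> ?C1" "g56 \<notin> ?C2"
    unfolding closure_g56_eq_NLie closure_M5_eq using g56_in_NLie by simp_all
  have C2: "M5 \<in> ?C2" "M5 \<notin> ?C1"
    unfolding closure_g56_eq_NLie using orbit_M5_eq orbit_refl[of M5] closure_of_subset[of "orbit M5" zariski]
    by auto
  have closed: "closedin (subtopology zariski NMal) (zariski closure_of orbit \<mu>)"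
    if "\<mu> \<in> NMal" for \<mu> :: "5 mult"
    using orbit_subset_NMal[OF that] zariski_closed_NMal
    by (simp add: closedin_closed_subtopology closedin_zariski closure_of_minimal)
  have irr: "irreducible_in (subtopology zariski NMal) (zariski closure_of orbit \<mu>)"
    if "\<mu> \<in> NMal" for \<mu> :: "5 mult"
    by (intro irreducible_closure_orbit zariski_closed_NMal orbit_subset_NMal that)
  have "irreducible_components (subtopology zariski NMal) = {?C1, ?C2}"
    by (rule irreducible_components_two) (use closed irr g56 M5_in_NMal cover C1 C2 in auto)
  moreover have ne: "orbit g56 \<noteq> orbit M5" "?C1 \<noteq> ?C2" using C1 C2 by auto
  moreover have "Rig (NMal :: 5 mult set) = {orbit g56, orbit M5}"
  proof -
    have "zariski_closed (?C2 \<union> fourth_power_zero \<union> left_rank_le_1)"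
      by (intro zariski_closed_Un zariski_closed_fourth_power_zero zariski_closed_left_rank_le_1)
        (simp flip: closedin_zariski)
    then have "rigid NMal g56" using g56 orbit_g56_eq rigid_if_closed_complement by blast
    moreover have "rigid NMal M5"
      using M5_in_NMal orbit_M5_eq zariski_closed_NLie rigid_if_closed_complement by blast
    \<comment> \<open>By \<open>cover\<close>, a rigid structure lies in one of the two closures, so
      its orbit is the one whose closure that is.\<close>
    moreover have "orbit \<mu> = orbit g56 \<or> orbit \<mu> = orbit M5" if "rigid NMal \<mu>" for \<mu> :: "5 mult"
      using that cover orbit_eq_if_rigid[OF that] orbit_subset_NMal g56 M5_in_NMal
      unfolding rigid_def by blast
    ultimately show ?thesis unfolding Rig_def by blast
  qed
  ultimately show ?thesis using closure_g56_eq_NLie closure_M5_eq by blast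
qed

end
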